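(* Let $R$ be a standard graded algebra over an infinite field $K$, let $d$ be a positive integer, and let $l_1,\dots,l_r$ ($r\ge 1$) be linear forms of $R$ satisfying property (Gr,$d$). Then \[ \dim_K (R/(l_1))_d \leq (\dim_K R_d)_{\langle d \rangle }. \]
   Context: A standard graded algebra over $K$ is a $K$-algebra of the form $K[X_1,\dots,X_n]/I$ with $I$ a homogeneous ideal (all variables of degree 1). Let $\mathfrak m$ be its homogeneous maximal ideal. Macaulay representation. Given a positive integer $d$, every non-negative integer $c$ can be written uniquely as $c=\binom{k_d}{d}+\binom{k_{d-1}}{d-1}+\dots+\binom{k_1}{1}$ with $k_d>k_{d-1}>\dots>k_1\ge 0$. One defines $c_{\langle d\rangle}=\binom{k_d-1}{d}+\binom{k_{d-1}-1}{d-1}+\dots+\binom{k_1-1}{1}$. Convention: $\binom{a}{b}=0$ whenever $a<b$ (including negative $a$). The ideals $I_{\mathbf o}$. Let $\mathbf l=l_1,\dots,l_r$ be a sequence of linear forms of $R$. For every $0\le i\le r$ and every sequence $\mathbf o=o_1,\dots,o_i$ of letters in $\{c,s\}$, define an ideal $I_{\mathbf o}=I_{\mathbf l,\mathbf o}$ of $R$ recursively: if $\mathbf o$ is empty, $I_{\mathbf o}=(0)$; if $\mathbf o=\bar{\mathbf o},o_{i+1}$ with $\bar{\mathbf o}=o_1,\dots,o_i$, then $I_{\mathbf o}=I_{\bar{\mathbf o}}:l_{i+1}$ if $o_{i+1}=c$, and $I_{\mathbf o}=I_{\bar{\mathbf o}}+(l_{i+1})$ if $o_{i+1}=s$. Let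 $|\mathbf o|_c$ be the number of letters $c$ in $\mathbf o$. Property (Gr,$d$). The linear forms $l_1,\dots,l_r$ satisfy (Gr,$d$), for $d>0$, if for every sequence $\mathbf o=o_1,\dots,o_i$ of letters in $\{c,s\}$ with $0\le i\le r$ the following hold: (i) if $\mathfrak m\not\subseteq I_{\mathbf o}$ and $i<r$, then $l_{i+1}\notin I_{\mathbf o}$; (ii) if $i=r$ and $|\mathbf o|_c<d$, then $\mathfrak m\subseteq I_{\mathbf o}$; (iii) if $i\le r-2$, then $\dim_K (I_{\mathbf o,c,s})_{d-|\mathbf o|_c-1}\le \dim_K (I_{\mathbf o,s,c})_{d-|\mathbf o|_c-1}$, where $\mathbf o,c,s$ (resp. $\mathbf o,s,c$) denotes the sequence $\mathbf o$ followed by $c,s$ (resp. by $s,c$), and graded components in negative degree are zero. *)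

theory Defs
  imports "HOL-Algebra.QuotRing" "HOL-Algebra.Embedded_Algebras" "HOL-Library.Poly_Mapping"
begin

section \<open>Polynomial rings\<close>

text \<open>A monomial is a finitely supported exponent vector, a polynomial a finitely supported
  function from monomials to coefficients; the product is the convolution product provided by
  the library.  Indeterminates are indexed by natural numbers.\<close>

type_synonym monomial = "nat \<Rightarrow>\<^sub>0 nat"
type_synonym 'k mpoly = "monomial \<Rightarrow>\<^sub>0 'k"

definition mpoly_ring :: "nat \<Rightarrow> ('k::field) mpoly ring" where
  "mpoly_ring n =
     \<lparr>carrier = {p. \<forall>m \<in> Poly_Mapping.keys p. Poly_Mapping.keys m \<subseteq> {..<n}},
      mult = (*), one = 1, zero = 0, add = (+)\<rparr>"

lemma mpoly_ring_cring: "cring (mpoly_ring n :: ('k::field) mpoly ring)"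
proof (rule cringI)
  let ?S = "mpoly_ring n :: 'k mpoly ring"
  have add: "p + q \<in> carrier ?S" if "p \<in> carrier ?S" "q \<in> carrier ?S" for p q
    using that Poly_Mapping.keys_add[of p q] by (fastforce simp: mpoly_ring_def)
  have mult: "p * q \<in> carrier ?S" if "p \<in> carrier ?S" "q \<in> carrier ?S" for p q
  proof -
    have "Poly_Mapping.keys m \<subseteq> {..<n}" if m: "m \<in> Poly_Mapping.keys (p * q)" for m
    proof -
      obtain a b where "m = a + b" "a \<in> Poly_Mapping.keys p" "b \<in> Poly_Mapping.keys q"
        using m keys_mult[of p q] by blast
      with \<open>p \<in> carrier ?S\<close> \<open>q \<in> carrier ?S\<close> Poly_Mapping.keys_add[of a b]
      show ?thesis by (fastforce simp: mpoly_ring_def)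
    qed
    then show ?thesis by (simp add: mpoly_ring_def)
  qed
  have uminus: "- p \<in> carrier ?S" if "p \<in> carrier ?S" for p
    using that by (simp add: mpoly_ring_def)
  show "abelian_group ?S"
  proof (rule abelian_groupI)
    show "\<exists>q \<in> carrier ?S. q \<oplus>\<^bsub>?S\<^esub> p = \<zero>\<^bsub>?S\<^esub>" if "p \<in> carrier ?S" for p
      using uminus[OF that] by (intro bexI[of _ "- p"]) (simp_all add: mpoly_ring_def)
    show "p \<oplus>\<^bsub>?S\<^esub> q \<in> carrier ?S" if "p \<in> carrier ?S" "q \<in> carrier ?S" for p q
      using add[OF that] by (simp add: mpoly_ring_def)
  qed (simp_all add: mpoly_ring_def add_ac)
  show "comm_monoid ?S"
  proof (rule comm_monoidI)
    show "p \<otimes>\<^bsub>?S\<^esub> q \<in> carrier ?S" if "p \<in> carrier ?S" "q \<in> carrier ?S" for p q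
      using mult[OF that] by (simp add: mpoly_ring_def)
  qed (simp_all add: mpoly_ring_def mult_ac)
qed (simp add: mpoly_ring_def distrib_right)

definition const_poly :: "'k::field \<Rightarrow> 'k mpoly" where
  "const_poly c = Poly_Mapping.single 0 c"

definition var_poly :: "nat \<Rightarrow> ('k::field) mpoly" where
  "var_poly i = Poly_Mapping.single (Poly_Mapping.single i 1) 1"

definition mon_degree :: "monomial \<Rightarrow> nat" where
  "mon_degree m = (\<Sum>i \<in> Poly_Mapping.keys m. Poly_Mapping.lookup m i)"

text \<open>Degrees are integers, so that the components of negative degree are \<open>{0}\<close>.\<close>

definition homog_polys :: "nat \<Rightarrow> int \<Rightarrow> ('k::field) mpoly set" where
  "homog_polys n j =
     {p \<in> carrier (mpoly_ring n). \<forall>m \<in> Poly_Mapping.keys p. int (mon_degree m) = j}"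

definition homogeneous_ideal :: "nat \<Rightarrow> ('k::field) mpoly set \<Rightarrow> bool" where
  "homogeneous_ideal n I \<longleftrightarrow> ideal I (mpoly_ring n) \<and>
     (\<exists>H. H \<subseteq> (\<Union>j. homog_polys n j) \<and> I = genideal (mpoly_ring n) H)"

section \<open>Standard graded algebras and their quotients\<close>

definition std_alg :: "nat \<Rightarrow> ('k::field) mpoly set \<Rightarrow> 'k mpoly set ring" where
  "std_alg n I = mpoly_ring n Quot I"

text \<open>The copy of the base field inside the algebra, used as the scalars for dimensions.\<close>

definition std_scalars :: "nat \<Rightarrow> ('k::field) mpoly set \<Rightarrow> 'k mpoly set set" where
  "std_scalars n I = range (\<lambda>c. I +>\<^bsub>mpoly_ring n\<^esub> const_poly c)"

definition std_comp :: "nat \<Rightarrow> ('k::field) mpoly set \<Rightarrow> int \<Rightarrow> 'k mpoly set set" where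
  "std_comp n I j = (\<lambda>p. I +>\<^bsub>mpoly_ring n\<^esub> p) ` homog_polys n j"

definition std_max_ideal :: "nat \<Rightarrow> ('k::field) mpoly set \<Rightarrow> 'k mpoly set set" where
  "std_max_ideal n I =
     genideal (std_alg n I) ((\<lambda>i. I +>\<^bsub>mpoly_ring n\<^esub> var_poly i) ` {..<n})"

definition std_dim :: "nat \<Rightarrow> ('k::field) mpoly set \<Rightarrow> 'k mpoly set set \<Rightarrow> nat" where
  "std_dim n I V = ring.dim (std_alg n I) (std_scalars n I) V"

text \<open>For a homogeneous ideal \<open>J\<close> of \<open>R\<close>, the graded component of degree \<open>j\<close> of \<open>R/J\<close> is the image
  of the one of \<open>R\<close>, and the scalars of \<open>R/J\<close> are the image of those of \<open>R\<close>.\<close>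

definition quot_comp_dim ::
    "nat \<Rightarrow> ('k::field) mpoly set \<Rightarrow> 'k mpoly set set \<Rightarrow> int \<Rightarrow> nat" where
  "quot_comp_dim n I J j =
     ring.dim (std_alg n I Quot J)
       ((\<lambda>x. J +>\<^bsub>std_alg n I\<^esub> x) ` std_scalars n I)
       ((\<lambda>x. J +>\<^bsub>std_alg n I\<^esub> x) ` std_comp n I j)"

section \<open>The ideals attached to a sequence of linear forms\<close>

datatype letter = Lc | Ls

definition colon_ideal :: "('a, 'b) ring_scheme \<Rightarrow> 'a set \<Rightarrow> 'a \<Rightarrow> 'a set" where
  "colon_ideal R J l = {x \<in> carrier R. x \<otimes>\<^bsub>R\<^esub> l \<in> J}"

definition seq_step :: "('a, 'b) ring_scheme \<Rightarrow> letter \<times> 'a \<Rightarrow> 'a set \<Rightarrow> 'a set" where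
  "seq_step R = (\<lambda>(a, l) J. case a of
      Lc \<Rightarrow> colon_ideal R J l
    | Ls \<Rightarrow> J <+>\<^bsub>R\<^esub> genideal R {l})"

text \<open>The letters of \<open>os\<close> are processed from left to right, the letter at position \<open>i\<close> with the
  form \<open>ls ! i\<close>.  The definition is meant for \<open>length os \<le> length ls\<close>.\<close>

definition seq_ideal :: "('a, 'b) ring_scheme \<Rightarrow> 'a list \<Rightarrow> letter list \<Rightarrow> 'a set" where
  "seq_ideal R ls os = fold (seq_step R) (zip os ls) {\<zero>\<^bsub>R\<^esub>}"

lemma seq_ideal_Nil: "seq_ideal R ls [] = {\<zero>\<^bsub>R\<^esub>}"
  by (simp add: seq_ideal_def)

lemma zip_snoc:
  "length os < length ls \<Longrightarrow> zip (os @ [a]) ls = zip os ls @ [(a, ls ! length os)]"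
proof (induction os arbitrary: ls)
  case Nil
  then show ?case by (cases ls) auto
next
  case (Cons b os)
  then show ?case by (cases ls) auto
qed

lemma seq_ideal_snoc:
  assumes "length os < length ls"
  shows "seq_ideal R ls (os @ [Lc]) = colon_ideal R (seq_ideal R ls os) (ls ! length os)"
    and "seq_ideal R ls (os @ [Ls]) = seq_ideal R ls os <+>\<^bsub>R\<^esub> genideal R {ls ! length os}"
  by (simp_all add: seq_ideal_def zip_snoc[OF assms] seq_step_def)

definition num_c :: "letter list \<Rightarrow> nat" where
  "num_c os = count_list os Lc"

definition Gr_property ::
    "nat \<Rightarrow> ('k::field) mpoly set \<Rightarrow> 'k mpoly set list \<Rightarrow> nat \<Rightarrow> bool" where
  "Gr_property n I ls d \<longleftrightarrow>
    (\<forall>os. length os \<le> length ls \<longrightarrow>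
      (\<not> std_max_ideal n I \<subseteq> seq_ideal (std_alg n I) ls os \<and> length os < length ls \<longrightarrow>
         ls ! length os \<notin> seq_ideal (std_alg n I) ls os) \<and>
      (length os = length ls \<and> num_c os < d \<longrightarrow>
         std_max_ideal n I \<subseteq> seq_ideal (std_alg n I) ls os) \<and>
      (length os + 2 \<le> length ls \<longrightarrow>
         std_dim n I (seq_ideal (std_alg n I) ls (os @ [Lc, Ls])
                        \<inter> std_comp n I (int d - int (num_c os) - 1))
         \<le> std_dim n I (seq_ideal (std_alg n I) ls (os @ [Ls, Lc])
                        \<inter> std_comp n I (int d - int (num_c os) - 1))))"

section \<open>Macaulay representations\<close>

text \<open>Being extensional outside \<open>{1..d}\<close> makes the representing function unique.\<close>

definition macaulay_rep :: "nat \<Rightarrow> nat \<Rightarrow> (nat \<Rightarrow> nat) \<Rightarrow> bool" where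
  "macaulay_rep d c k \<longleftrightarrow> k \<in> extensional {1..d} \<and> strict_mono_on {1..d} k \<and>
     c = (\<Sum>i = 1..d. k i choose i)"

text \<open>If \<open>k i = 0\<close>, then \<open>k i - 1\<close> is truncated to \<open>0\<close> instead of being \<open>-1\<close>; for \<open>i \<ge> 1\<close>
  the binomial coefficient is zero in either case.\<close>

definition macaulay_lower :: "nat \<Rightarrow> nat \<Rightarrow> nat" where
  "macaulay_lower c d =
     (let k = (THE k. macaulay_rep d c k) in \<Sum>i = 1..d. (k i - 1) choose i)"

lemma macaulay_sum_less:
  assumes "strict_mono_on {1..d} k" "d \<ge> 1"
  shows "(\<Sum>i = 1..d. k i choose i) < Suc (k d) choose d"
  using assms
proof (induction d)
  case 0
  then show ?case by simp
next
  case (Suc d)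
  show ?case
  proof (cases "d = 0")
    case True
    then show ?thesis by simp
  next
    case False
    have "strict_mono_on {1..d} k"
      using Suc.prems(1) by (rule monotone_on_subset) auto
    then have "(\<Sum>i = 1..d. k i choose i) < Suc (k d) choose d"
      using Suc.IH False by simp
    also have "k d < k (Suc d)"
      using Suc.prems(1) False by (auto intro: strict_mono_onD)
    then have "Suc (k d) choose d \<le> k (Suc d) choose d"
      by (intro binomial_right_mono) simp
    finally show ?thesis by simp
  qed
qed

lemma macaulay_rep_unique:
  assumes "macaulay_rep d c k" "macaulay_rep d c k'"
  shows "k = k'"
proof -
  have *: "\<forall>i \<in> {1..d}. k i = k' i"
    if "strict_mono_on {1..d} k" "strict_mono_on {1..d} k'"
      "(\<Sum>i = 1..d. k i choose i) = (\<Sum>i = 1..d. k' i choose i)"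
    using that
  proof (induction d)
    case 0
    then show ?case by simp
  next
    case (Suc d)
    have no_less: False
      if "strict_mono_on {1..Suc d} a" "a (Suc d) < b (Suc d)"
        "(\<Sum>i = 1..Suc d. a i choose i) = (\<Sum>i = 1..Suc d. b i choose i)" for a b :: "nat \<Rightarrow> nat"
    proof -
      have "(\<Sum>i = 1..Suc d. a i choose i) < Suc (a (Suc d)) choose Suc d"
        using that(1) by (intro macaulay_sum_less) auto
      also have "\<dots> \<le> b (Suc d) choose Suc d"
        using that(2) by (intro binomial_right_mono) simp
      also have "\<dots> \<le> (\<Sum>i = 1..Suc d. b i choose i)" by simp
      finally show False using that(3) by simp
    qed
    have eq: "k (Suc d) = k' (Suc d)"
      using no_less[of k k'] no_less[of k' k] Suc.prems by (metis linorder_neqE_nat)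
    have "\<forall>i \<in> {1..d}. k i = k' i"
    proof (rule Suc.IH)
      show "strict_mono_on {1..d} k" "strict_mono_on {1..d} k'"
        using Suc.prems(1,2) by (auto intro: monotone_on_subset)
      show "(\<Sum>i = 1..d. k i choose i) = (\<Sum>i = 1..d. k' i choose i)"
        using Suc.prems(3) eq by simp
    qed
    with eq show ?case by (auto simp: le_Suc_eq)
  qed
  show ?thesis
    using assms * unfolding macaulay_rep_def by (intro extensionalityI[of k "{1..d}"]) auto
qed

lemma macaulay_rep_exists:
  assumes "d > 0"
  shows "\<exists>k. macaulay_rep d c k"
proof -
  have ex: "\<exists>k. strict_mono_on {1..d} k \<and> c = (\<Sum>i = 1..d. k i choose i)"
    using assms
  proof (induction d arbitrary: c)
    case 0
    then show ?case by simp
  next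
    case (Suc d)
    show ?case
    proof (cases "d = 0")
      case True
      show ?thesis
        by (rule exI[of _ "\<lambda>_. c"]) (use True in \<open>auto simp: monotone_on_def\<close>)
    next
      case False
      define M where "M = {m. m choose Suc d \<le> c}"
      have "m \<le> c + d" if "m \<in> M" for m
      proof (rule ccontr)
        assume "\<not> m \<le> c + d"
        then have "(c + Suc d) choose Suc d \<le> m choose Suc d"
          by (intro binomial_right_mono) simp
        moreover have "c < (c + Suc d) choose Suc d"
        proof -
          have "0 < (c + Suc d) choose d" for c :: nat by (simp add: zero_less_binomial_iff)
          then show ?thesis
            by (induction c) (simp_all add: Suc_lessI less_trans_Suc)
        qed
        ultimately show False using that by (simp add: M_def)
      qed
      then have fin: "finite M" by (meson finite_nat_set_iff_bounded_le)
      have "0 \<in> M" by (simp add: M_def)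
      define m where "m = Max M"
      have mM: "m choose Suc d \<le> c" 
      proof -
        have "m \<in> M" unfolding m_def using fin \<open>0 \<in> M\<close> by (intro Max_in) auto
        then show ?thesis by (simp add: M_def)
      qed
      have "Suc m \<notin> M" using Max_ge[OF fin, of "Suc m"] by (auto simp: m_def)
      then have lt: "c < Suc m choose Suc d" by (simp add: M_def)
      define c' where "c' = c - (m choose Suc d)"
      from Suc.IH[of c'] False obtain k where
        k: "strict_mono_on {1..d} k" "c' = (\<Sum>i = 1..d. k i choose i)" by blast
      have "k d < m"
      proof (rule ccontr)
        assume "\<not> k d < m"
        then have "m choose d \<le> k d choose d" by (intro binomial_right_mono) simp
        also have "\<dots> \<le> c'" unfolding k(2) using False
          by (intro member_le_sum) auto
        finally show False using lt mM by (simp add: c'_def)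
      qed
      have less: "k i < m" if "i \<in> {1..d}" for i
      proof -
        have "k i \<le> k d"
          using strict_mono_on_leD[OF k(1), of i d] that by auto
        with \<open>k d < m\<close> show ?thesis by simp
      qed
      show ?thesis
      proof (intro exI conjI)
        show "strict_mono_on {1..Suc d} (k(Suc d := m))"
          using strict_mono_onD[OF k(1)] less by (auto simp: monotone_on_def le_Suc_eq)
        have "(\<Sum>i = 1..d. (k(Suc d := m)) i choose i) = c'"
          unfolding k(2) by (intro sum.cong) auto
        then show "c = (\<Sum>i = 1..Suc d. (k(Suc d := m)) i choose i)"
          using mM by (simp add: c'_def)
      qed
    qed
  qed
  then obtain k where k: "strict_mono_on {1..d} k" "c = (\<Sum>i = 1..d. k i choose i)" by blast
  have "macaulay_rep d c (restrict k {1..d})"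
    using k by (auto simp: macaulay_rep_def monotone_on_def intro!: sum.cong)
  then show ?thesis by blast
qed

lemma macaulay_rep_ex1: "d > 0 \<Longrightarrow> \<exists>!k. macaulay_rep d c k"
  using macaulay_rep_exists macaulay_rep_unique by blast

end

theory Submission
  imports Defs
begin

text \<open>Put \<open>h(o) = dim (R/I\<^sub>o)\<^sub>D\<close> with \<open>D = d - |o|\<^sub>c\<close>.  Multiplication by the next linear form gives
  \<open>h(o) = h(o,c) + h(o,s)\<close>, and (iii) says \<open>h(o,s,c) \<le> h(o,c,s)\<close>.  Writing \<open>x = h(o,s)\<close>, induction
  on the number of remaining forms, applied to \<open>(o,c)\<close> and \<open>(o,s)\<close>, yields Green's inequality
  \<open>x \<le> (h(o) - x)\<^bsub>\<langle>D-1\<rangle>\<^esub> + x\<^bsub>\<langle>D\<rangle>\<^esub>\<close>, which forces \<open>x \<le> h(o)\<^bsub>\<langle>D\<rangle>\<^esub>\<close> by a property of Macaulay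
  representations; (i) settles \<open>D = 1\<close> and (ii) the last form.  The dimensions can be computed in the
  polynomial ring, as codimensions of graded components of the preimages of the ideals \<open>I\<^sub>o\<close>.\<close>

section \<open>Macaulay representations\<close>

text \<open>The induction hypothesis only bounds sequences ending in \<open>s\<close>, so the
  summand \<open>h(o,s,c)\<close> that arises from splitting \<open>h(o,s)\<close> is out of its
  reach. Condition (iii) exchanges it for \<open>h(o,c,s)\<close>, which the hypothesis for
  \<open>(o,c)\<close> bounds in terms of \<open>h(o,c) = h(o) - x\<close>. The degree
  \<open>D\<close> falls by one with every letter \<open>c\<close>, as multiplication by a linear
  form requires; hence \<open>D - 1\<close> in the first term and \<open>D\<close> in the second.
  The price is an inequality with \<open>x\<close> on both sides, and resolving it is the purely
  numerical part of the proof. The rings \<open>R/I_o\<close> have different carriers; computing in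
  the polynomial ring places every dimension in one vector space. That space has infinite dimension,
  so the linear algebra carries finite spanning sets along.\<close>

lemma macaulay_lower_eq:
  assumes "macaulay_rep d c k"
  shows "macaulay_lower c d = (\<Sum>i = 1..d. (k i - 1) choose i)"
  using the_equality[of "macaulay_rep d c", OF assms macaulay_rep_unique[OF _ assms]]
  by (simp add: macaulay_lower_def)

text \<open>The value \<open>c\<close> at \<open>d = 0\<close> makes the recursion \<open>green_Suc\<close> hold from \<open>d = 0\<close> on.\<close>

definition green :: "nat \<Rightarrow> nat \<Rightarrow> nat" where
  "green d c = (if d = 0 then c else macaulay_lower c d)"

lemma green_1: "green (Suc 0) c = c - 1"
proof -
  have "macaulay_rep 1 c (restrict (\<lambda>_. c) {1..1})"
    by (auto simp: macaulay_rep_def monotone_on_def)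
  from macaulay_lower_eq[OF this] show ?thesis by (simp add: green_def)
qed

text \<open>The bound on \<open>e\<close> puts the top entry of its representation below
  \<open>k\<close>, so appending \<open>k\<close> in position \<open>d + 1\<close> yields the
  representation of the sum, and lowering acts term by term. At \<open>d = 0\<close> the bound
  leaves only \<open>e = 0\<close>.\<close>

lemma green_Suc_less:
  assumes "e < k choose d"
  shows "green (Suc d) ((k choose Suc d) + e) = ((k - 1) choose Suc d) + green d e"
proof (cases "d = 0")
  case True
  then show ?thesis using assms by (simp add: green_1) (simp add: green_def)
next
  case False
  obtain f where f: "macaulay_rep d e f" using macaulay_rep_exists False by blast
  have mono: "strict_mono_on {1..d} f" and e: "e = (\<Sum>i = 1..d. f i choose i)"
    using f by (auto simp: macaulay_rep_def)
  have "f d < k"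
  proof (rule ccontr)
    assume "\<not> f d < k"
    then have "k choose d \<le> f d choose d" by (intro binomial_right_mono) simp
    also have "\<dots> \<le> e" unfolding e using False by (intro member_le_sum) auto
    finally show False using assms by simp
  qed
  have less: "f i < k" if "i \<in> {1..d}" for i
    using strict_mono_on_leD[OF mono, of i d] that \<open>f d < k\<close> by fastforce
  have "macaulay_rep (Suc d) ((k choose Suc d) + e) (f(Suc d := k))"
    unfolding macaulay_rep_def
  proof (intro conjI)
    show "f(Suc d := k) \<in> extensional {1..Suc d}"
      using f by (auto simp: macaulay_rep_def extensional_def)
    show "strict_mono_on {1..Suc d} (f(Suc d := k))"
      using strict_mono_onD[OF mono] less by (auto simp: monotone_on_def le_Suc_eq)
    have "(\<Sum>i = 1..d. (f(Suc d := k)) i choose i) = e"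
      unfolding e by (intro sum.cong) auto
    then show "(k choose Suc d) + e = (\<Sum>i = 1..Suc d. (f(Suc d := k)) i choose i)" by simp
  qed
  from macaulay_lower_eq[OF this]
  have "green (Suc d) ((k choose Suc d) + e) =
    (\<Sum>i = 1..d. ((f(Suc d := k)) i - 1) choose i) + ((k - 1) choose Suc d)"
    by (simp add: green_def)
  also have "(\<Sum>i = 1..d. ((f(Suc d := k)) i - 1) choose i) = green d e"
    using False macaulay_lower_eq[OF f] by (auto simp: green_def intro!: sum.cong)
  finally show ?thesis by simp
qed

lemma green_0_right [simp]: "green d 0 = 0"
proof (induction d)
  case (Suc d)
  \<comment> \<open>With \<open>k = d\<close> both leading binomials vanish, while
    \<open>0 < d choose d\<close> still holds.\<close>
  then show ?case using green_Suc_less[of 0 d d] by (simp add: binomial_eq_0)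
qed (simp add: green_def)

lemma green_choose: "green d (k choose d) = (k - 1) choose d" if "k > 0"
proof (cases d)
  case (Suc m)
  show ?thesis
  proof (cases "k < m")
    case False
    then have "0 < k choose m" by (simp add: zero_less_binomial_iff)
    from green_Suc_less[OF this] show ?thesis by (simp add: Suc)
  qed (simp add: Suc binomial_eq_0)
qed (use that in \<open>simp add: green_def\<close>)

text \<open>At the boundary \<open>e = k choose d\<close> the sum is no longer an expansion led by
  \<open>k\<close>: Pascal's rule turns it into \<open>Suc k choose Suc d\<close>. Pascal's rule for
  the lowered binomials shows that the formula persists. This slack allows raising \<open>e\<close>
  by one without changing \<open>k\<close>.\<close>

lemma green_Suc:
  assumes "e \<le> k choose d" "k > 0"
  shows "green (Suc d) ((k choose Suc d) + e) = ((k - 1) choose Suc d) + green d e"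
proof (cases "e < k choose d")
  case False
  then have e: "e = k choose d" using assms by simp
  obtain j where j: "k = Suc j" using assms gr0_implies_Suc by blast
  have "(k choose Suc d) + e = Suc k choose Suc d" by (simp add: e)
  then have "green (Suc d) ((k choose Suc d) + e) = k choose Suc d"
    by (simp only: green_choose) simp
  also have "\<dots> = (j choose Suc d) + green d e" using green_choose[of k d] by (simp add: e j)
  finally show ?thesis by (simp add: j)
qed (rule green_Suc_less)

text \<open>The leading entry of the representation serves as \<open>k\<close>: since
  \<open>c < Suc k choose Suc d\<close>, Pascal's rule bounds the remainder by
  \<open>k choose d\<close>. That bound makes \<open>k choose d\<close> nonzero, hence
  \<open>d \<le> k\<close>.\<close>

lemma macaulay_split:
  obtains k e where "c = (k choose Suc d) + e" "e < k choose d" "d \<le> k"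
proof -
  obtain f where "macaulay_rep (Suc d) c f" using macaulay_rep_exists by blast
  then have f: "strict_mono_on {1..Suc d} f" "c = (\<Sum>i = 1..Suc d. f i choose i)"
    by (auto simp: macaulay_rep_def)
  have "c < Suc (f (Suc d)) choose Suc d" using macaulay_sum_less[OF f(1)] f(2) by simp
  moreover have "c \<ge> f (Suc d) choose Suc d" using f(2) by simp
  ultimately have "c = (f (Suc d) choose Suc d) + (c - (f (Suc d) choose Suc d))"
    "c - (f (Suc d) choose Suc d) < f (Suc d) choose d" by auto
  moreover from this(2) have "d \<le> f (Suc d)"
    by (metis not_less_zero binomial_eq_0 not_le)
  ultimately show ?thesis using that by blast
qed

text \<open>If \<open>c\<close> has leading entry \<open>k\<close> and remainder \<open>e\<close>,
  then \<open>green_Suc\<close> still applies to \<open>Suc e\<close> with the same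
  \<open>k\<close>. The increment at \<open>c\<close> is therefore the increment of
  \<open>green d\<close> at \<open>e\<close>.\<close>

lemma green_Suc_right: "green d c \<le> green d (Suc c) \<and> green d (Suc c) \<le> Suc (green d c)"
proof (induction d arbitrary: c)
  case 0
  then show ?case by (simp add: green_def)
next
  case (Suc d)
  show ?case
  proof (cases "d = 0")
    case False
    obtain k e where c: "c = (k choose Suc d) + e" "e < k choose d" "d \<le> k"
      by (rule macaulay_split)
    with False have "k > 0" by simp
    with c Suc[of e] show ?thesis
      using green_Suc[of e k d] green_Suc[of "Suc e" k d] by simp
  qed (simp add: green_1)
qed

lemma green_mono: "c \<le> c' \<Longrightarrow> green d c \<le> green d c'"
  by (rule lift_Suc_mono_le[of "green d"]) (use green_Suc_right in auto)

lemma green_add_le: "green d (c + j) \<le> green d c + j"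
proof (induction j)
  case (Suc j)
  then show ?case using green_Suc_right[of d "c + j"] by simp
qed simp

lemma green_le: "green d c \<le> c"
  using green_add_le[of d 0 c] by simp

text \<open>The inequality of \<open>green_self_bound\<close> fails at \<open>x = green d c + 1\<close>.  Since \<open>green d\<close> is monotone
  with increments at most \<open>1\<close>, it then fails for all larger \<open>x\<close>.\<close>

lemma green_split_key:
  assumes "c > 0" "d > 0"
  shows "green d (green d c + 1) + green (d - 1) (c - green d c - 1) \<le> green d c"
  using assms
proof (induction d arbitrary: c)
  case (Suc d)
  show ?case
  proof (cases "d = 0")
    case True
    then show ?thesis using Suc.prems by (simp add: green_1 green_def[of 0])
  next
    case False
    obtain k e where c: "c = (k choose Suc d) + e" "e < k choose d" "d \<le> k"
      by (rule macaulay_split)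
    obtain j where j: "k = Suc j" using c(3) False by (metis gr0_implies_Suc gr_zeroI le_zero_eq)
    obtain b where b: "d = Suc b" using False gr0_implies_Suc by blast
    have gc: "green (Suc d) c = (j choose Suc d) + green d e"
      using green_Suc_less[OF c(2)] c(1) by (simp add: j)
    have g_le: "green d e \<le> j choose d"
      using green_mono[of e "k choose d" d] green_choose[of k d] c(2) by (simp add: j)
    \<comment> \<open>Increments of \<open>green d\<close> are at most one, so
      \<open>e - green d e\<close> is nondecreasing in \<open>e\<close>. It is thus bounded by its
      value at \<open>k choose d\<close>, which Pascal's rule identifies as
      \<open>j choose b\<close>.\<close>
    have u_le: "e - green d e \<le> j choose b"
    proof -
      have "green d (k choose d) \<le> green d e + ((k choose d) - e)"
        using green_add_le[of d e "(k choose d) - e"] c(2) by simp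
      then show ?thesis using green_choose[of k d] c(2) by (simp add: j b)
    qed
    have diff: "c - green (Suc d) c - 1 = (j choose d) + (e - green d e) - 1"
    proof -
      have "c = (j choose d) + (j choose Suc d) + e" by (simp add: c(1) j)
      then show ?thesis using gc green_le[of d e] by simp
    qed
    have one: "green d 1 = 0"
      using green_choose[of d d] False by simp
    show ?thesis
    proof (cases "e = 0")
      \<comment> \<open>Here \<open>c\<close> is a single binomial. Passing from \<open>j\<close> to
        \<open>i = j - 1\<close> in both summands gives \<open>i choose Suc d\<close> and at most
        \<open>i choose d\<close>, which add up to \<open>j choose Suc d\<close>.\<close>
      case True
      with Suc.prems c(1) have "0 < k choose Suc d" by simp
      then have "Suc d \<le> k" by (simp only: zero_less_binomial_iff)
      then have "d \<le> j" by (simp add: j)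
      then have "j > 0" "1 \<le> j choose d" using False
        by (auto simp: Suc_le_eq zero_less_binomial_iff)
      then obtain i where i: "j = Suc i" using gr0_implies_Suc by blast
      have "green (Suc d) ((j choose Suc d) + 1) = (i choose Suc d)"
        using green_Suc[of 1 j d] \<open>j > 0\<close> \<open>1 \<le> j choose d\<close> one by (simp add: i)
      moreover have "green d ((j choose d) - 1) \<le> i choose d"
        using green_mono[of "(j choose d) - 1" "j choose d" d] green_choose[of j d] by (simp add: i)
      ultimately show ?thesis
        unfolding diff unfolding gc using True by (simp add: i)
    next
      case e: False
      have "green d e < e"
        using green_add_le[of d 1 "e - 1"] one e by simp
      have "k \<noteq> d" using c(2) e by auto
      then have "d \<le> j" using c(3) by (simp add: j)
      then obtain i where i: "j = Suc i" using False by (metis Suc_le_D b)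
      show ?thesis
      proof (cases "green d e < j choose d")
        case True
        \<comment> \<open>Both arguments now split with leading entry \<open>j\<close>. The leading
          parts recombine by Pascal's rule, and what remains is the induction hypothesis at
          \<open>e\<close>.\<close>
        have "green (Suc d) ((j choose Suc d) + (green d e + 1)) =
            (i choose Suc d) + green d (green d e + 1)"
          using green_Suc[of "green d e + 1" j d] True by (simp add: i)
        moreover have "green d ((j choose d) + (e - green d e - 1)) =
            (i choose d) + green b (e - green d e - 1)"
          using green_Suc[of "e - green d e - 1" j b] u_le by (simp add: i b)
        moreover have "green d (green d e + 1) + green b (e - green d e - 1) \<le> green d e"
          using Suc.IH[of e] e False by (simp add: b)
        ultimately show ?thesis
          unfolding diff unfolding gc using \<open>green d e < e\<close> by (simp add: i add.assoc)
      next
        case g: False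
        \<comment> \<open>Now \<open>green (Suc d) c\<close> is exactly
          \<open>k choose Suc d\<close>, so its successor has leading entry \<open>k\<close> and
          remainder 1, and the remainder contributes nothing. The other summand is at most
          \<open>green d (k choose d)\<close>.\<close>
        then have g: "green d e = j choose d" using g_le by simp
        have "green (Suc d) ((k choose Suc d) + 1) = j choose Suc d"
          using green_Suc[of 1 k d] one c(2) e by (simp add: j)
        moreover have "green d ((j choose d) + (e - green d e) - 1) \<le> j choose d"
          using green_mono[of "(j choose d) + (e - green d e) - 1" "k choose d" d]
            green_choose[of k d] u_le by (simp add: j b)
        ultimately show ?thesis
          unfolding diff unfolding gc using g by (simp add: j ac_simps)
      qed
    qed
  qed
qed simp

lemma green_self_bound:
  assumes "x \<le> c" "d > 0" "x \<le> green (d - 1) (c - x) + green d x"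
  shows "x \<le> green d c"
proof (rule ccontr)
  assume less: "\<not> x \<le> green d c"
  define y where "y = green d c + 1"
  have "y \<le> x" using less by (simp add: y_def)
  then have "green d x \<le> green d y + (x - y)" using green_add_le[of d y "x - y"] by simp
  moreover have "green (d - 1) (c - x) \<le> green (d - 1) (c - y)"
    using \<open>y \<le> x\<close> by (intro green_mono) simp
  ultimately have "y \<le> green (d - 1) (c - y) + green d y" using assms(3) \<open>y \<le> x\<close> by simp
  moreover have "c > 0" using less assms(1) by simp
  ultimately show False using green_split_key[of c d] assms(2) by (simp add: y_def)
qed

section \<open>Dimensions in vector spaces without finite global dimension\<close>

context vector_space
begin

text \<open>The set \<open>F\<close> ensures that bases are finite: \<open>dim\<close> is the
  cardinality of a basis and would collapse to 0 on an infinite one.\<close>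

lemma dim_insert_new:
  assumes "subspace E" "E \<subseteq> span F" "finite F" "v \<notin> E"
  shows "dim (span (insert v E)) = Suc (dim E)"
proof -
  obtain B where B: "B \<subseteq> E" "independent B" "E \<subseteq> span B" "card B = dim E"
    using basis_exists by blast
  have "finite B" using independent_span_bound[OF assms(3) B(2)] B(1) assms(2) by blast
  have E: "span B = E" using B assms(1) span_minimal by blast
  then have "independent (insert v B)" "v \<notin> B"
    using B assms(4) independent_insertI by blast+
  moreover have "span (insert v E) = span (insert v B)"
    unfolding span_insert by (simp only: flip: E) (simp only: span_span)
  ultimately show ?thesis using dim_span_eq_card_independent \<open>finite B\<close> B(4) by simp
qed

lemma dim_mono_finite_span:
  assumes "B \<subseteq> A" "A \<subseteq> span F" "finite F"
  shows "dim B \<le> dim A"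
proof -
  obtain C where C: "C \<subseteq> A" "independent C" "A \<subseteq> span C" "card C = dim A"
    using basis_exists by blast
  have "finite C" using independent_span_bound[OF assms(3) C(2)] C(1) assms(2) by blast
  then show ?thesis using dim_le_card[of B C] assms(1) C by auto
qed

lemma dim_strict_mono_finite_span:
  assumes "subspace B" "subspace A" "B \<subset> A" "A \<subseteq> span F" "finite F"
  shows "dim B < dim A"
proof -
  obtain v where v: "v \<in> A" "v \<notin> B" using assms(3) by blast
  have "span (insert v B) \<subseteq> A" using v assms(2,3) by (intro span_minimal) auto
  then have "dim (span (insert v B)) \<le> dim A" by (rule dim_mono_finite_span) fact+
  moreover have "dim (span (insert v B)) = Suc (dim B)"
    using assms v(2) by (intro dim_insert_new[of B F]) auto
  ultimately show ?thesis by simp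
qed

text \<open>A basis of \<open>A\<close> is adjoined to \<open>B\<close> vector by vector, skipping
  those already in the span, so each step raises the dimension by exactly one. Rank-nullity
  arguments start it at \<open>B\<close>, the kernel.\<close>

lemma subspace_extend_induct [consumes 5, case_names base step]:
  assumes "subspace A" "A \<subseteq> span F" "finite F" "subspace B" "B \<subseteq> A"
    and base: "P B"
    and step: "\<And>E v. subspace E \<Longrightarrow> B \<subseteq> E \<Longrightarrow> E \<subseteq> A \<Longrightarrow> v \<in> A \<Longrightarrow> v \<notin> E \<Longrightarrow> P E \<Longrightarrow>
      P (span (insert v E))"
  shows "P A"
proof -
  obtain C where C: "C \<subseteq> A" "independent C" "A \<subseteq> span C" "card C = dim A"
    by (rule basis_exists[of A])
  have "finite C" using independent_span_bound[OF assms(3) C(2)] C(1) assms(2) by blast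
  have "P (span (B \<union> G))" if "finite G" "G \<subseteq> A" for G
    using that
  proof (induction G)
    case empty
    have "span B = B" using assms(4) by simp
    with base show ?case by (simp only: Un_empty_right)
  next
    case (insert v G)
    let ?E = "span (B \<union> G)"
    have eq: "span (B \<union> insert v G) = span (insert v ?E)"
      by (simp only: Un_insert_right span_insert span_span)
    have "?E \<subseteq> A" using insert.prems assms(1,5) by (intro span_minimal) auto
    show ?case
    proof (cases "v \<in> ?E")
      case True
      then show ?thesis using insert by (simp add: span_redundant)
    next
      case False
      show ?thesis
        unfolding eq
        using insert \<open>?E \<subseteq> A\<close> False by (intro step) (auto intro: span_base)
    qed
  qed
  from this[OF \<open>finite C\<close> C(1)] have "P (span (B \<union> C))" .
  then show ?thesis
  proof -
    have "span (B \<union> C) \<subseteq> A" using C(1) assms(1,5) by (intro span_minimal) auto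
    moreover have "A \<subseteq> span (B \<union> C)" using C(3) span_mono[of C "B \<union> C"] by blast
    ultimately show ?thesis using \<open>P (span (B \<union> C))\<close> by simp
  qed
qed

lemma dim_sum_image:
  assumes f_add: "\<And>x y. f (x + y) = f x + f y" and f_scale: "\<And>c x. f (c *s x) = c *s f x"
    and A: "subspace A" "A \<subseteq> span F" "finite F"
    and B: "subspace B" "B \<subseteq> span G" "finite G"
  shows "dim {b + f a | b a. b \<in> B \<and> a \<in> A} + dim {a \<in> A. f a \<in> B} = dim A + dim B"
proof -
  have f_diff: "f (x - y) = f x - f y" for x y
    using f_add[of "x - y" y] by (simp add: algebra_simps)
  have f_0: "f 0 = 0" using f_add[of 0 0] by simp
  let ?S = "\<lambda>E. {b + f a | b a. b \<in> B \<and> a \<in> E}"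
  let ?N = "{a \<in> A. f a \<in> B}"
  have subS: "subspace (?S E)" if "subspace E" for E
  proof (rule subspaceI)
    show "0 \<in> ?S E" using subspace_0[OF B(1)] subspace_0[OF that] f_0 by force
  next
    fix x y assume "x \<in> ?S E" "y \<in> ?S E"
    then obtain b a b' a' where "x = b + f a" "y = b' + f a'" "b \<in> B" "a \<in> E" "b' \<in> B" "a' \<in> E"
      by blast
    then have "x + y = (b + b') + f (a + a')" "b + b' \<in> B" "a + a' \<in> E"
      using subspace_add[OF B(1)] subspace_add[OF that] by (auto simp: f_add)
    then show "x + y \<in> ?S E" by blast
  next
    fix c x assume "x \<in> ?S E"
    then obtain b a where "x = b + f a" "b \<in> B" "a \<in> E" by blast
    then have "c *s x = c *s b + f (c *s a)" "c *s b \<in> B" "c *s a \<in> E"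
      using subspace_scale[OF B(1)] subspace_scale[OF that]
      by (auto simp: f_scale scale_right_distrib)
    then show "c *s x \<in> ?S E" by blast
  qed
  define N where "N = ?N"
  have N: "subspace N"
    unfolding N_def using A(1) B(1) by (auto simp: subspace_def f_add f_scale f_0)
  have N_A: "N \<subseteq> A" by (auto simp: N_def)
  have N_mem: "x \<in> N" if "x \<in> A" "f x \<in> B" for x using that by (simp add: N_def)
  have N_B: "f x \<in> B" if "x \<in> N" for x using that by (simp add: N_def)
  have "dim (?S A) + dim N = dim A + dim B"
    \<comment> \<open>The kernel stays fixed while \<open>A\<close> is built up from it, so every
      new vector enlarges both the domain and the sum by one dimension.\<close>
    using A N N_A
  proof (induction A rule: subspace_extend_induct)
    case base
    have "?S N \<subseteq> B" using subspace_add[OF B(1)] N_B by blast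
    moreover have "B \<subseteq> ?S N"
    proof
      fix b assume "b \<in> B"
      then have "b = b + f 0 \<and> b \<in> B \<and> 0 \<in> N" using subspace_0[OF N] f_0 by simp
      then show "b \<in> ?S N" by blast
    qed
    ultimately have "?S N = B" by (rule subset_antisym)
    then show ?case by simp
  next
    case (step E v)
    have fin: "E \<subseteq> span F" using step A by blast
    have spanE: "span E = E" and spanS: "span (?S E) = ?S E"
      using step(1) subS[OF step(1)] by simp_all
    have eq: "?S (span (insert v E)) = span (insert (f v) (?S E))"
    proof (intro subset_antisym subsetI)
      fix x assume "x \<in> ?S (span (insert v E))"
      then obtain b a k where "x = b + f a" "b \<in> B" "a - k *s v \<in> E"
        by (auto simp only: span_breakdown_eq spanE)
      then have "x - k *s f v = b + f (a - k *s v)" by (simp add: f_diff f_scale)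
      then have "x - k *s f v \<in> ?S E" using \<open>b \<in> B\<close> \<open>a - k *s v \<in> E\<close> by blast
      then show "x \<in> span (insert (f v) (?S E))"
        unfolding span_breakdown_eq spanS by blast
    next
      fix x assume "x \<in> span (insert (f v) (?S E))"
      then obtain k where "x - k *s f v \<in> ?S E"
        unfolding span_breakdown_eq spanS by blast
      then obtain b a where "x - k *s f v = b + f a" "b \<in> B" "a \<in> E" by blast
      then have "x = b + f (a + k *s v)" "b \<in> B" "a + k *s v \<in> span (insert v E)"
        using span_base[of a "insert v E"] span_base[of v "insert v E"]
        by (simp_all add: f_add f_scale algebra_simps span_add span_scale)
      then show "x \<in> ?S (span (insert v E))" by blast
    qed
    \<comment> \<open>A representation \<open>f v = b + f a\<close> would put \<open>v - a\<close>
      into the kernel, which lies in \<open>E\<close>, and hence \<open>v\<close> into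
      \<open>E\<close>.\<close>
    have "f v \<notin> ?S E"
    proof
      assume "f v \<in> ?S E"
      then obtain b a where ba: "f v = b + f a" "b \<in> B" "a \<in> E" by blast
      then have "v - a \<in> N"
        using step(3,4) A(1) by (intro N_mem) (auto simp: f_diff intro: subspace_diff)
      then have "v - a + a \<in> E" using step(1,2) ba(3) subspace_add by blast
      then show False using step(5) by simp
    qed
    moreover have "?S E \<subseteq> span (G \<union> f ` F)"
    proof
      fix x assume "x \<in> ?S E"
      then obtain b a where x: "x = b + f a" "b \<in> span G" "a \<in> span F" using fin B(2) by blast
      have "f a \<in> span (f ` F)"
        using x(3)
      proof (induction rule: span_induct_alt)
        case base then show ?case by (simp add: f_0 span_zero)
      next
        case (step c x y)
        then show ?case by (simp add: f_add f_scale span_add span_scale span_base)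
      qed
      then show "x \<in> span (G \<union> f ` F)"
        using x span_mono[of G "G \<union> f ` F"] span_mono[of "f ` F" "G \<union> f ` F"]
        by (auto intro!: span_add)
    qed
    ultimately have "dim (span (insert (f v) (?S E))) = Suc (dim (?S E))"
      using A(3) B(3) subS[OF step(1)] dim_insert_new[of "?S E" "G \<union> f ` F" "f v"] by blast
    moreover have "dim (span (insert v E)) = Suc (dim E)"
      using step fin A(3) by (intro dim_insert_new)
    ultimately show ?case using step(6) by (simp only: eq)
  qed
  then show ?thesis by (simp only: N_def)
qed

end

section \<open>Graded ideals of the polynomial ring\<close>

lemma const_poly_add: "const_poly (a + b) = const_poly a + const_poly b"
  by (simp add: const_poly_def single_add)

lemma const_poly_mult: "const_poly (a * b) = const_poly a * const_poly b"
  by (simp add: const_poly_def mult_single)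

lemma const_poly_0 [simp]: "const_poly 0 = 0"
  by (simp add: const_poly_def)

lemma const_poly_1 [simp]: "const_poly 1 = 1"
  by (simp add: const_poly_def)

text \<open>The vector space is the whole type, with all indeterminates at once; the spaces of forms
  for a given \<open>n\<close> are finite-dimensional subspaces of it.\<close>

definition mpoly_scale :: "'k::field \<Rightarrow> 'k mpoly \<Rightarrow> 'k mpoly" where
  "mpoly_scale c p = const_poly c * p"

interpretation mpoly: vector_space "mpoly_scale :: 'k::field \<Rightarrow> 'k mpoly \<Rightarrow> 'k mpoly"
  by unfold_locales
    (simp_all add: mpoly_scale_def const_poly_add const_poly_mult algebra_simps)

lemma mpoly_ring_simps [simp]:
  "mult (mpoly_ring n) = (*)" "one (mpoly_ring n) = 1"
  "zero (mpoly_ring n) = 0" "add (mpoly_ring n) = (+)"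
  by (simp_all add: mpoly_ring_def)

lemma mpoly_carrier_iff:
  "p \<in> carrier (mpoly_ring n) \<longleftrightarrow> (\<forall>m \<in> Poly_Mapping.keys p. Poly_Mapping.keys m \<subseteq> {..<n})"
  by (simp add: mpoly_ring_def)

lemma single_carrier: "Poly_Mapping.keys m \<subseteq> {..<n} \<Longrightarrow> Poly_Mapping.single m c \<in> carrier (mpoly_ring n)"
  by (simp add: mpoly_carrier_iff)

lemma const_poly_carrier [simp]: "const_poly c \<in> carrier (mpoly_ring n)"
  by (simp add: const_poly_def single_carrier)

lemma var_poly_carrier: "i < n \<Longrightarrow> var_poly i \<in> carrier (mpoly_ring n)"
  by (simp add: var_poly_def single_carrier)

lemma mpoly_carrier_add:
  "p \<in> carrier (mpoly_ring n) \<Longrightarrow> q \<in> carrier (mpoly_ring n) \<Longrightarrow> p + q \<in> carrier (mpoly_ring n)"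
  using ring.ring_simprules(1)[OF cring.axioms(1)[OF mpoly_ring_cring]] by fastforce

lemma mpoly_carrier_mult:
  "p \<in> carrier (mpoly_ring n) \<Longrightarrow> q \<in> carrier (mpoly_ring n) \<Longrightarrow> p * q \<in> carrier (mpoly_ring n)"
  using ring.ring_simprules(5)[OF cring.axioms(1)[OF mpoly_ring_cring]] by fastforce

lemma mpoly_carrier_0 [simp]: "0 \<in> carrier (mpoly_ring n)"
  by (simp add: mpoly_carrier_iff)

lemma mpoly_carrier_1 [simp]: "1 \<in> carrier (mpoly_ring n)"
  using const_poly_carrier[of 1] by simp

lemma mpoly_carrier_uminus: "p \<in> carrier (mpoly_ring n) \<Longrightarrow> - p \<in> carrier (mpoly_ring n)"
  by (simp add: mpoly_carrier_iff)

lemma mpoly_a_inv: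
  assumes "p \<in> carrier (mpoly_ring n)"
  shows "\<ominus>\<^bsub>mpoly_ring n\<^esub> p = - p"
proof -
  interpret cring "mpoly_ring n" by (rule mpoly_ring_cring)
  show ?thesis
    using minus_equality[of "- p" p] assms mpoly_carrier_uminus[OF assms] by simp
qed

section \<open>Degrees and homogeneous components\<close>

lemma mon_degree_superset:
  assumes "finite A" "Poly_Mapping.keys m \<subseteq> A"
  shows "mon_degree m = (\<Sum>i \<in> A. Poly_Mapping.lookup m i)"
  unfolding mon_degree_def using assms
  by (intro sum.mono_neutral_left) (auto simp: in_keys_iff)

lemma mon_degree_add: "mon_degree (a + b) = mon_degree a + mon_degree b"
proof -
  let ?A = "Poly_Mapping.keys a \<union> Poly_Mapping.keys b"
  have "mon_degree (a + b) = (\<Sum>i \<in> ?A. Poly_Mapping.lookup (a + b) i)"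
    using Poly_Mapping.keys_add[of a b] by (intro mon_degree_superset) auto
  moreover have "mon_degree a = (\<Sum>i \<in> ?A. Poly_Mapping.lookup a i)"
    "mon_degree b = (\<Sum>i \<in> ?A. Poly_Mapping.lookup b i)"
    by (intro mon_degree_superset; simp)+
  ultimately show ?thesis by (simp add: lookup_add sum.distrib)
qed

lemma mpoly_sum_single:
  "p = (\<Sum>m \<in> Poly_Mapping.keys p. Poly_Mapping.single m (Poly_Mapping.lookup p m))"
  by (rule poly_mapping_eqI)
    (auto simp: lookup_sum lookup_single when_def in_keys_iff sum.delta)

definition hcomp :: "int \<Rightarrow> ('k::field) mpoly \<Rightarrow> 'k mpoly" where
  "hcomp j p = (\<Sum>m \<in> {m \<in> Poly_Mapping.keys p. int (mon_degree m) = j}.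
     Poly_Mapping.single m (Poly_Mapping.lookup p m))"

lemma lookup_hcomp:
  "Poly_Mapping.lookup (hcomp j p) m = (if int (mon_degree m) = j then Poly_Mapping.lookup p m else 0)"
  by (auto simp: hcomp_def lookup_sum lookup_single when_def in_keys_iff sum.delta)

lemma hcomp_add: "hcomp j (p + q) = hcomp j p + hcomp j q"
  by (rule poly_mapping_eqI) (simp add: lookup_hcomp lookup_add)

lemma hcomp_0 [simp]: "hcomp j 0 = 0"
  by (simp add: hcomp_def)

lemma hcomp_sum: "hcomp j (sum f A) = (\<Sum>x \<in> A. hcomp j (f x))"
  by (induction A rule: infinite_finite_induct) (simp_all add: hcomp_add)

lemma hcomp_single:
  "hcomp j (Poly_Mapping.single m c) = (if int (mon_degree m) = j then Poly_Mapping.single m c else 0)"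
  by (rule poly_mapping_eqI) (auto simp: lookup_hcomp lookup_single when_def)

text \<open>Multiplying by a monomial shifts degrees. Integer degrees matter: for \<open>j\<close>
  below the degree of \<open>m\<close> both sides vanish, whereas truncated subtraction would pick
  out the constant term of \<open>p\<close>.\<close>

lemma hcomp_mult_single:
  "hcomp j (p * Poly_Mapping.single m c) = hcomp (j - int (mon_degree m)) p * Poly_Mapping.single m c"
proof -
  let ?s = "\<lambda>a. Poly_Mapping.single a (Poly_Mapping.lookup p a)"
  have "hcomp j ((\<Sum>a \<in> Poly_Mapping.keys p. ?s a) * Poly_Mapping.single m c) =
      hcomp (j - int (mon_degree m)) (\<Sum>a \<in> Poly_Mapping.keys p. ?s a) * Poly_Mapping.single m c"
    unfolding sum_distrib_right hcomp_sum
    by (intro sum.cong) (auto simp: mult_single hcomp_single mon_degree_add)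
  then show ?thesis by (simp only: flip: mpoly_sum_single)
qed

lemma homog_polys_iff:
  "p \<in> homog_polys n j \<longleftrightarrow> p \<in> carrier (mpoly_ring n) \<and> (\<forall>m \<in> Poly_Mapping.keys p. int (mon_degree m) = j)"
  by (auto simp: homog_polys_def)

lemma homog_polys_carrier: "p \<in> homog_polys n j \<Longrightarrow> p \<in> carrier (mpoly_ring n)"
  by (simp add: homog_polys_iff)

lemma hcomp_mult_homog:
  assumes "q \<in> homog_polys n i"
  shows "hcomp j (p * q) = hcomp (j - i) p * q"
proof -
  let ?s = "\<lambda>a. Poly_Mapping.single a (Poly_Mapping.lookup q a)"
  have "hcomp j (p * (\<Sum>a \<in> Poly_Mapping.keys q. ?s a)) =
      hcomp (j - i) p * (\<Sum>a \<in> Poly_Mapping.keys q. ?s a)"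
    unfolding sum_distrib_left hcomp_sum
    using assms by (intro sum.cong) (auto simp: hcomp_mult_single homog_polys_iff)
  then show ?thesis by (simp only: flip: mpoly_sum_single)
qed

lemma hcomp_homog:
  assumes "p \<in> homog_polys n i"
  shows "hcomp j p = (if i = j then p else 0)"
  using assms by (intro poly_mapping_eqI) (auto simp: lookup_hcomp homog_polys_iff in_keys_iff)

lemma hcomp_in_homog:
  assumes "p \<in> carrier (mpoly_ring n)"
  shows "hcomp j p \<in> homog_polys n j"
  using assms by (auto simp: homog_polys_iff mpoly_carrier_iff in_keys_iff lookup_hcomp split: if_splits)

lemma homog_polys_mult:
  assumes "p \<in> homog_polys n i" "q \<in> homog_polys n j"
  shows "p * q \<in> homog_polys n (i + j)"
proof -
  have "hcomp (i + j) (p * q) = p * q"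
    using hcomp_mult_homog[OF assms(2)] hcomp_homog[OF assms(1)] by simp
  then show ?thesis
    using hcomp_in_homog[of "p * q" n "i + j"] assms mpoly_carrier_mult homog_polys_carrier by metis
qed

lemma subspace_homog_polys: "mpoly.subspace (homog_polys n j :: ('k::field) mpoly set)"
proof (rule mpoly.subspaceI)
  fix p q :: "'k mpoly" assume "p \<in> homog_polys n j" "q \<in> homog_polys n j"
  then show "p + q \<in> homog_polys n j"
    using Poly_Mapping.keys_add[of p q] mpoly_carrier_add by (fastforce simp: homog_polys_iff)
next
  fix c :: 'k and p :: "'k mpoly" assume p: "p \<in> homog_polys n j"
  have "const_poly c \<in> homog_polys n 0"
    by (auto simp: homog_polys_iff) (auto simp: const_poly_def mon_degree_def split: if_splits)
  from homog_polys_mult[OF this p] show "mpoly_scale c p \<in> homog_polys n j"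
    by (simp add: mpoly_scale_def)
qed (simp add: homog_polys_iff)

text \<open>Exponents of a monomial of degree \<open>j\<close> are at most \<open>j\<close>, so
  restricting exponent vectors to \<open>n\<close> positions embeds these monomials into a finite
  function space.\<close>

lemma homog_polys_finite_span:
  obtains F where "finite F" "homog_polys n j \<subseteq> mpoly.span (F :: ('k::field) mpoly set)"
proof -
  define M where "M = {m :: monomial. Poly_Mapping.keys m \<subseteq> {..<n} \<and> int (mon_degree m) = j}"
  define F where "F = (\<lambda>m. Poly_Mapping.single m (1 :: 'k)) ` M"
  have "finite M"
  proof (rule inj_on_finite)
    show "inj_on (\<lambda>m. restrict (Poly_Mapping.lookup m) {..<n}) M"
    proof (rule inj_onI)
      fix a b assume ab: "a \<in> M" "b \<in> M"
        "restrict (Poly_Mapping.lookup a) {..<n} = restrict (Poly_Mapping.lookup b) {..<n}"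
      show "a = b"
      proof (rule poly_mapping_eqI)
        fix i
        show "Poly_Mapping.lookup a i = Poly_Mapping.lookup b i"
        proof (cases "i < n")
          case True
          then show ?thesis using fun_cong[OF ab(3), of i] by simp
        next
          case False
          then have "i \<notin> Poly_Mapping.keys a" "i \<notin> Poly_Mapping.keys b"
            using ab(1,2) by (auto simp: M_def)
          then show ?thesis by (simp add: in_keys_iff)
        qed
      qed
    qed
    show "(\<lambda>m. restrict (Poly_Mapping.lookup m) {..<n}) ` M \<subseteq> {..<n} \<rightarrow>\<^sub>E {..nat j}"
    proof clarsimp
      fix m i assume m: "m \<in> M" and "i < n"
      have "mon_degree m = (\<Sum>i<n. Poly_Mapping.lookup m i)"
        using m by (intro mon_degree_superset) (auto simp: M_def)
      moreover have "Poly_Mapping.lookup m i \<le> (\<Sum>i<n. Poly_Mapping.lookup m i)"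
        using \<open>i < n\<close> by (intro member_le_sum) auto
      ultimately show "Poly_Mapping.lookup m i \<le> nat j" using m by (simp add: M_def nat_le_iff le_nat_iff flip: of_nat_sum)
    qed
  qed (auto intro!: finite_PiE)
  then have "finite F" by (simp add: F_def)
  moreover have "homog_polys n j \<subseteq> mpoly.span F"
  proof
    fix p :: "'k mpoly" assume p: "p \<in> homog_polys n j"
    have "(\<Sum>m \<in> Poly_Mapping.keys p. Poly_Mapping.single m (Poly_Mapping.lookup p m)) \<in> mpoly.span F"
    proof (rule mpoly.span_sum)
      fix m assume "m \<in> Poly_Mapping.keys p"
      then have "Poly_Mapping.single m 1 \<in> F"
        using p by (auto simp: F_def M_def homog_polys_iff mpoly_carrier_iff)
      then have "mpoly_scale (Poly_Mapping.lookup p m) (Poly_Mapping.single m 1) \<in> mpoly.span F"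
        by (intro mpoly.span_scale mpoly.span_base)
      then show "Poly_Mapping.single m (Poly_Mapping.lookup p m) \<in> mpoly.span F"
        by (simp add: mpoly_scale_def const_poly_def mult_single)
    qed
    then show "p \<in> mpoly.span F" by (simp only: flip: mpoly_sum_single)
  qed
  ultimately show ?thesis by (rule that)
qed

text \<open>Closure under components, rather than generation by homogeneous elements, is the form of
  homogeneity that passes directly to colon ideals.\<close>

definition graded_ideal :: "nat \<Rightarrow> ('k::field) mpoly set \<Rightarrow> bool" where
  "graded_ideal n J \<longleftrightarrow> ideal J (mpoly_ring n) \<and> (\<forall>p \<in> J. \<forall>j. hcomp j p \<in> J)"

lemma mpoly_idealI:
  assumes "J \<subseteq> carrier (mpoly_ring n)" "0 \<in> J" "\<And>p q. p \<in> J \<Longrightarrow> q \<in> J \<Longrightarrow> p + q \<in> J"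
    and mult: "\<And>p q. p \<in> carrier (mpoly_ring n) \<Longrightarrow> q \<in> J \<Longrightarrow> p * q \<in> J"
  shows "ideal J (mpoly_ring n)"
proof -
  interpret cring "mpoly_ring n" by (rule mpoly_ring_cring)
  show ?thesis
  proof (rule idealI[OF ring_axioms])
    show "subgroup J (add_monoid (mpoly_ring n))"
    proof (rule add.subgroupI)
      fix p assume "p \<in> J"
      moreover from this have "(- 1) * p \<in> J"
        using mpoly_carrier_uminus[OF mpoly_carrier_1] by (intro mult)
      ultimately show "\<ominus>\<^bsub>mpoly_ring n\<^esub> p \<in> J"
        using assms(1) by (subst mpoly_a_inv) auto
    qed (use assms in auto)
    show "q \<otimes>\<^bsub>mpoly_ring n\<^esub> p \<in> J" "p \<otimes>\<^bsub>mpoly_ring n\<^esub> q \<in> J"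
      if "p \<in> J" "q \<in> carrier (mpoly_ring n)" for p q
      using mult[OF that(2,1)] by (simp_all add: mult.commute)
  qed
qed

lemma mpoly_idealD:
  assumes "ideal J (mpoly_ring n)"
  shows "J \<subseteq> carrier (mpoly_ring n)" "0 \<in> J" "\<And>p q. p \<in> J \<Longrightarrow> q \<in> J \<Longrightarrow> p + q \<in> J"
    and "\<And>p q. p \<in> carrier (mpoly_ring n) \<Longrightarrow> q \<in> J \<Longrightarrow> p * q \<in> J"
    and "\<And>p q. p \<in> J \<Longrightarrow> q \<in> J \<Longrightarrow> p - q \<in> J"
proof -
  interpret ideal J "mpoly_ring n" by fact
  show sub: "J \<subseteq> carrier (mpoly_ring n)" by (rule a_subset)
  show "0 \<in> J" using additive_subgroup.zero_closed[OF is_additive_subgroup] by simp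
  show add: "p + q \<in> J" if "p \<in> J" "q \<in> J" for p q using additive_subgroup.a_closed[OF is_additive_subgroup that] by simp
  show mult: "p * q \<in> J" if "p \<in> carrier (mpoly_ring n)" "q \<in> J" for p q
    using I_l_closed[OF that(2,1)] by simp
  show "p - q \<in> J" if "p \<in> J" "q \<in> J" for p q
    using add[OF that(1) mult[OF mpoly_carrier_uminus[OF mpoly_carrier_1] that(2)]] by simp
qed

lemma mpoly_ideal_sum:
  assumes "ideal J (mpoly_ring n)" "\<And>x. x \<in> A \<Longrightarrow> f x \<in> J"
  shows "sum f A \<in> J"
  using assms(2)
  by (induction A rule: infinite_finite_induct) (auto intro: mpoly_idealD[OF assms(1)])

text \<open>The polynomials with all components in \<open>I\<close> form an ideal \<open>G\<close>:
  a multiplier is split into monomials, each of which merely shifts components. As \<open>G\<close>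
  contains the generators, it contains \<open>I\<close>.\<close>

lemma homogeneous_imp_graded_ideal:
  fixes I :: "('k::field) mpoly set"
  assumes "homogeneous_ideal n I"
  shows "graded_ideal n I"
proof -
  obtain H where I: "ideal I (mpoly_ring n)" and H: "H \<subseteq> (\<Union>j. homog_polys n j)"
    and gen: "I = genideal (mpoly_ring n) H"
    using assms by (auto simp: homogeneous_ideal_def)
  note ID = mpoly_idealD[OF I]
  interpret cring "mpoly_ring n" by (rule mpoly_ring_cring)
  define G where "G = {p \<in> carrier (mpoly_ring n). \<forall>j. hcomp j p \<in> I}"
  have Hc: "H \<subseteq> carrier (mpoly_ring n)" using H homog_polys_carrier by blast
  have "ideal G (mpoly_ring n)"
  proof (rule mpoly_idealI)
    fix p q :: "'k mpoly" assume p: "p \<in> carrier (mpoly_ring n)" and q: "q \<in> G"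
    have "hcomp j (p * q) \<in> I" for j
    proof -
      let ?s = "\<lambda>a. Poly_Mapping.single a (Poly_Mapping.lookup p a)"
      have "hcomp j ((\<Sum>a \<in> Poly_Mapping.keys p. ?s a) * q) \<in> I"
        unfolding sum_distrib_right hcomp_sum
      proof (rule mpoly_ideal_sum[OF I])
        fix a assume "a \<in> Poly_Mapping.keys p"
        then have "?s a \<in> carrier (mpoly_ring n)"
          using p by (intro single_carrier) (auto simp: mpoly_carrier_iff)
        then have "?s a * hcomp (j - int (mon_degree a)) q \<in> I"
          using q by (intro ID) (auto simp: G_def)
        then show "hcomp j (?s a * q) \<in> I"
          by (simp add: hcomp_mult_single mult.commute)
      qed
      then show ?thesis by (simp only: flip: mpoly_sum_single)
    qed
    then show "p * q \<in> G" using p q mpoly_carrier_mult by (auto simp: G_def)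
  qed (use ID mpoly_carrier_add in \<open>auto simp: G_def hcomp_add\<close>)
  moreover have "H \<subseteq> G"
  proof
    fix p assume p: "p \<in> H"
    then obtain i where "p \<in> homog_polys n i" using H by blast
    moreover have "p \<in> I" using p genideal_self[OF Hc] by (auto simp: gen)
    ultimately show "p \<in> G" using ID by (auto simp: G_def hcomp_homog homog_polys_carrier)
  qed
  ultimately have "I \<subseteq> G" unfolding gen by (rule genideal_minimal)
  then show ?thesis using I by (auto simp: graded_ideal_def G_def)
qed

text \<open>\<open>mcolon\<close> and \<open>mplus\<close> are the preimages of the steps for the
  letters \<open>Lc\<close> and \<open>Ls\<close>, with \<open>l\<close> a polynomial lifting the
  linear form.\<close>

definition mcolon :: "nat \<Rightarrow> ('k::field) mpoly set \<Rightarrow> 'k mpoly \<Rightarrow> 'k mpoly set" where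
  "mcolon n J l = {p \<in> carrier (mpoly_ring n). p * l \<in> J}"

definition mplus :: "nat \<Rightarrow> ('k::field) mpoly set \<Rightarrow> 'k mpoly \<Rightarrow> 'k mpoly set" where
  "mplus n J l = {p + q * l | p q. p \<in> J \<and> q \<in> carrier (mpoly_ring n)}"

lemma graded_mcolon:
  fixes J :: "('k::field) mpoly set"
  assumes "graded_ideal n J" "l \<in> homog_polys n i"
  shows "graded_ideal n (mcolon n J l)"
proof -
  have J: "ideal J (mpoly_ring n)" and h: "\<And>p j. p \<in> J \<Longrightarrow> hcomp j p \<in> J"
    using assms(1) by (auto simp: graded_ideal_def)
  note JD = mpoly_idealD[OF J]
  have "ideal (mcolon n J l) (mpoly_ring n)"
    by (rule mpoly_idealI)
      (auto simp: mcolon_def JD mpoly_carrier_add mpoly_carrier_mult distrib_right mult.assoc)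
  \<comment> \<open>Component \<open>j\<close> of \<open>p\<close> times \<open>l\<close> is
    component \<open>j + i\<close> of \<open>p * l\<close>.\<close>
  moreover have "hcomp j p \<in> mcolon n J l" if "p \<in> mcolon n J l" for j p
    using that h[of "p * l" "j + i"] hcomp_mult_homog[OF assms(2), of "j + i" p]
      homog_polys_carrier[OF hcomp_in_homog] by (auto simp: mcolon_def)
  ultimately show ?thesis by (simp add: graded_ideal_def)
qed

lemma graded_mplus:
  fixes J :: "('k::field) mpoly set"
  assumes "graded_ideal n J" "l \<in> homog_polys n i"
  shows "graded_ideal n (mplus n J l)"
proof -
  have J: "ideal J (mpoly_ring n)" and h: "\<And>p j. p \<in> J \<Longrightarrow> hcomp j p \<in> J"
    using assms(1) by (auto simp: graded_ideal_def)
  note JD = mpoly_idealD[OF J]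
  note l = homog_polys_carrier[OF assms(2)]
  have "ideal (mplus n J l) (mpoly_ring n)"
  proof (rule mpoly_idealI)
    show "mplus n J l \<subseteq> carrier (mpoly_ring n)"
      using JD(1) l by (auto simp: mplus_def intro!: mpoly_carrier_add mpoly_carrier_mult)
    show "0 \<in> mplus n J l"
      unfolding mplus_def using JD(2) by (intro CollectI exI[of _ 0]) simp
  next
    fix x y assume "x \<in> mplus n J l" "y \<in> mplus n J l"
    then obtain p q p' q' where "x = p + q * l" "y = p' + q' * l" "p \<in> J" "p' \<in> J"
      "q \<in> carrier (mpoly_ring n)" "q' \<in> carrier (mpoly_ring n)" by (auto simp: mplus_def)
    then have "x + y = (p + p') + (q + q') * l" "p + p' \<in> J" "q + q' \<in> carrier (mpoly_ring n)"
      by (auto simp: algebra_simps JD mpoly_carrier_add)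
    then show "x + y \<in> mplus n J l" unfolding mplus_def by blast
  next
    fix x y :: "'k mpoly" assume y: "y \<in> carrier (mpoly_ring n)" and "x \<in> mplus n J l"
    then obtain p q where "x = p + q * l" "p \<in> J" "q \<in> carrier (mpoly_ring n)"
      by (auto simp: mplus_def)
    then have "y * x = y * p + (y * q) * l" "y * p \<in> J" "y * q \<in> carrier (mpoly_ring n)"
      using y by (auto simp: distrib_left mult.assoc JD mpoly_carrier_mult)
    then show "y * x \<in> mplus n J l" unfolding mplus_def by blast
  qed
  moreover have "hcomp j x \<in> mplus n J l" if x: "x \<in> mplus n J l" for j x
  proof -
    obtain p q where "x = p + q * l" "p \<in> J" "q \<in> carrier (mpoly_ring n)"
      using x by (auto simp: mplus_def)
    then have "hcomp j x = hcomp j p + hcomp (j - i) q * l" "hcomp j p \<in> J"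
      "hcomp (j - i) q \<in> carrier (mpoly_ring n)"
      using h homog_polys_carrier[OF hcomp_in_homog]
      by (auto simp: hcomp_add hcomp_mult_homog[OF assms(2)])
    then show ?thesis unfolding mplus_def by blast
  qed
  ultimately show ?thesis by (simp add: graded_ideal_def)
qed

lemma subspace_graded:
  assumes "ideal J (mpoly_ring n)"
  shows "mpoly.subspace (J \<inter> homog_polys n j)"
  using mpoly_idealD[OF assms] subspace_homog_polys[of n j]
  by (auto simp: mpoly.subspace_def mpoly_scale_def)

text \<open>A monomial of positive degree is divisible by a variable. This turns containment of the
  maximal ideal into vanishing of all positive degrees of the quotient.\<close>

lemma homog_polys_subset_ideal:
  assumes J: "ideal J (mpoly_ring n)" and "\<And>i. i < n \<Longrightarrow> var_poly i \<in> J" and "j > 0"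
  shows "homog_polys n j \<subseteq> J"
proof
  fix p :: "'a mpoly" assume p: "p \<in> homog_polys n j"
  have "(\<Sum>m \<in> Poly_Mapping.keys p. Poly_Mapping.single m (Poly_Mapping.lookup p m)) \<in> J"
  proof (rule mpoly_ideal_sum[OF J])
    fix m assume "m \<in> Poly_Mapping.keys p"
    then have m: "Poly_Mapping.keys m \<subseteq> {..<n}" "int (mon_degree m) = j"
      using p by (auto simp: homog_polys_iff mpoly_carrier_iff)
    then have "Poly_Mapping.keys m \<noteq> {}" using assms(3) by (auto simp: mon_degree_def)
    then obtain i where i: "i \<in> Poly_Mapping.keys m" by blast
    define r where "r = m - Poly_Mapping.single i 1"
    have eq: "m = r + Poly_Mapping.single i 1"
      using i by (intro poly_mapping_eqI)
        (auto simp: r_def lookup_add lookup_minus lookup_single when_def in_keys_iff)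
    have "Poly_Mapping.keys r \<subseteq> {..<n}"
      using m(1) by (auto simp: r_def in_keys_iff lookup_minus subset_iff)
    then have "Poly_Mapping.single r (Poly_Mapping.lookup p m) * var_poly i \<in> J"
      using i m(1) by (intro mpoly_idealD[OF J] single_carrier assms) auto
    then show "Poly_Mapping.single m (Poly_Mapping.lookup p m) \<in> J"
      by (simp add: var_poly_def mult_single eq[unfolded One_nat_def, symmetric])
  qed
  then show "p \<in> J" by (simp only: flip: mpoly_sum_single)
qed

section \<open>Dimensions of images and of graded components\<close>

lemma subfield_const_polys: "subfield (range (const_poly :: 'k::field \<Rightarrow> _)) (mpoly_ring n)"
proof -
  interpret cring "mpoly_ring n :: 'k mpoly ring" by (rule mpoly_ring_cring)
  let ?K = "range (const_poly :: 'k \<Rightarrow> _)"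
  have neg: "\<ominus>\<^bsub>mpoly_ring n\<^esub> const_poly c = const_poly (- c)" for c :: 'k
    by (simp add: mpoly_a_inv) (simp add: const_poly_def single_uminus)
  have "subring ?K (mpoly_ring n)"
  proof (rule subringI)
    show "\<one>\<^bsub>mpoly_ring n\<^esub> \<in> ?K" using const_poly_1 by (metis mpoly_ring_simps(2) rangeI)
  qed (auto simp: neg simp flip: const_poly_add const_poly_mult)
  then have "subcring ?K (mpoly_ring n)"
    by (rule subcringI) (auto simp: mult.commute)
  moreover have "Units (mpoly_ring n \<lparr>carrier := ?K\<rparr>) = ?K - {\<zero>\<^bsub>mpoly_ring n\<^esub>}"
  proof (intro subset_antisym subsetI)
    fix x assume x: "x \<in> ?K - {\<zero>\<^bsub>mpoly_ring n\<^esub>}"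
    then obtain c where "x = const_poly c" by auto
    with x have c: "x = const_poly c" "c \<noteq> 0" by auto
    then have "const_poly (inverse c) * x = 1" "x * const_poly (inverse c) = 1"
      by (simp_all flip: const_poly_mult)
    then show "x \<in> Units (mpoly_ring n \<lparr>carrier := ?K\<rparr>)" using c by (auto simp: Units_def)
  qed (auto simp: Units_def)
  ultimately show ?thesis by (rule subfieldI)
qed

text \<open>Settles the zero ring, which occurs when \<open>I\<close> is the unit ideal. There the
  image of the base field is not a subfield, so the general uniqueness of dimension does not
  apply.\<close>

lemma (in ring) dimension_trivial:
  assumes "dimension k K E" "carrier R = {\<zero>}"
  shows "k = 0"
  using assms
proof (induction rule: dimension.induct)
  case (Suc_dim v E n K)
  then have "n = 0" by simp
  with Suc_dim(3) have "E = {\<zero>}" by (auto elim: dimension.cases)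
  then show ?case using Suc_dim by auto
qed simp

text \<open>Bridge between two notions of dimension: \<open>mpoly.dim\<close> counts a basis,
  \<open>dimension\<close> counts successive line extensions. Building \<open>A\<close> up from the
  kernel of \<open>h\<close>, each new vector adds one line to the image.\<close>

lemma dim_hom_image:
  fixes A F :: "('k::field) mpoly set"
  assumes hom: "ring_hom_ring (mpoly_ring n) R h"
    and A: "mpoly.subspace A" "A \<subseteq> carrier (mpoly_ring n)" "A \<subseteq> mpoly.span F" "finite F"
  shows "ring.dim R (h ` range const_poly) (h ` A) = mpoly.dim A - mpoly.dim {a \<in> A. h a = \<zero>\<^bsub>R\<^esub>}"
proof -
  interpret h: ring_hom_ring "mpoly_ring n" R h by (rule hom)
  let ?S = "carrier (mpoly_ring n) :: 'k mpoly set" and ?K = "h ` range const_poly"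
  have add: "h (p + q) = h p \<oplus>\<^bsub>R\<^esub> h q" if "p \<in> ?S" "q \<in> ?S" for p q
    using h.hom_add[OF that] by simp
  have scale: "h (mpoly_scale c p) = h (const_poly c) \<otimes>\<^bsub>R\<^esub> h p" if "p \<in> ?S" for c p
    using h.hom_mult[of "const_poly c" p] that by (simp add: mpoly_scale_def)
  have scale_S: "mpoly_scale c p \<in> ?S" if "p \<in> ?S" for c p
    using that by (simp add: mpoly_scale_def mpoly_carrier_mult)
  have closed: "h p \<in> carrier R" if "p \<in> ?S" for p using that by simp
  have h0: "h 0 = \<zero>\<^bsub>R\<^esub>" using h.hom_zero by simp
  define N where "N = {a \<in> A. h a = \<zero>\<^bsub>R\<^esub>}"
  have N: "mpoly.subspace N"
    unfolding N_def
  proof (rule mpoly.subspaceI)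
    fix c :: 'k and p assume "p \<in> {a \<in> A. h a = \<zero>\<^bsub>R\<^esub>}"
    then show "mpoly_scale c p \<in> {a \<in> A. h a = \<zero>\<^bsub>R\<^esub>}"
      using A(2) closed[OF const_poly_carrier] by (auto simp: scale mpoly.subspace_scale[OF A(1)])
  qed (auto simp: add subsetD[OF A(2)] h0 mpoly.subspace_0[OF A(1)] mpoly.subspace_add[OF A(1)])
  have "N \<subseteq> A" by (auto simp: N_def)
  have "\<exists>k. mpoly.dim A = mpoly.dim N + k \<and> h.S.dimension k ?K (h ` A)"
    using A(1,3,4) N \<open>N \<subseteq> A\<close>
  proof (induction A rule: mpoly.subspace_extend_induct)
    case base
    have "h ` N = {\<zero>\<^bsub>R\<^esub>}" using mpoly.subspace_0[OF N] h0 by (auto simp: N_def)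
    then show ?case by auto
  next
    case (step E v)
    obtain k where k: "mpoly.dim E = mpoly.dim N + k" "h.S.dimension k ?K (h ` E)"
      using step by blast
    have vS: "v \<in> ?S" and ES: "E \<subseteq> ?S" using step A(2) by auto
    have new: "h v \<notin> h ` E"
    proof
      assume "h v \<in> h ` E"
      then obtain e where e: "e \<in> E" "h v = h e" by blast
      then have "h (v - e) \<oplus>\<^bsub>R\<^esub> h e = \<zero>\<^bsub>R\<^esub> \<oplus>\<^bsub>R\<^esub> h e"
        using add[of "v - e" e] vS ES mpoly_carrier_add[of v n "- e"]
        by (auto simp: mpoly_carrier_uminus)
      moreover have ve: "v - e \<in> A" using e step A(1) mpoly.subspace_diff by blast
      ultimately have "h (v - e) = \<zero>\<^bsub>R\<^esub>"
        using h.S.add.right_cancel A(2) e ES closed by (metis h.S.zero_closed subsetD)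
      then have "v - e \<in> E" using ve step by (auto simp: N_def)
      then have "v - e + e \<in> E" using e step mpoly.subspace_add by blast
      then show False using step by simp
    qed
    have spanE: "mpoly.span E = E" using step by simp
    have "h ` mpoly.span (insert v E) = h.S.line_extension ?K (h v) (h ` E)"
    proof (intro subset_antisym subsetI)
      fix x assume "x \<in> h ` mpoly.span (insert v E)"
      then obtain p c where p: "x = h p" "p - mpoly_scale c v \<in> E"
        by (auto simp: mpoly.span_breakdown_eq spanE)
      then have "x = h (const_poly c) \<otimes>\<^bsub>R\<^esub> h v \<oplus>\<^bsub>R\<^esub> h (p - mpoly_scale c v)"
        using add[of "mpoly_scale c v" "p - mpoly_scale c v"] vS ES scale scale_S by auto
      then show "x \<in> h.S.line_extension ?K (h v) (h ` E)"
        using p unfolding h.S.line_extension_mem_iff by blast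
    next
      fix x assume "x \<in> h.S.line_extension ?K (h v) (h ` E)"
      then obtain c e where e: "x = h (const_poly c) \<otimes>\<^bsub>R\<^esub> h v \<oplus>\<^bsub>R\<^esub> h e" "e \<in> E"
        unfolding h.S.line_extension_mem_iff by blast
      then have "x = h (mpoly_scale c v + e)"
        using add[of "mpoly_scale c v" e] vS ES scale scale_S by auto
      moreover have "mpoly_scale c v + e \<in> mpoly.span (insert v E)"
        using e by (intro mpoly.span_add mpoly.span_scale) (auto intro: mpoly.span_base)
      ultimately show "x \<in> h ` mpoly.span (insert v E)" by blast
    qed
    moreover have "h.S.dimension (Suc k) ?K (h.S.line_extension ?K (h v) (h ` E))"
      using k vS new by (intro h.S.dimension.Suc_dim) auto
    moreover have "mpoly.dim (mpoly.span (insert v E)) = Suc (mpoly.dim E)"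
      using step A by (intro mpoly.dim_insert_new[of E F]) auto
    ultimately show ?case using k(1) by (intro exI[of _ "Suc k"]) simp
  qed
  then obtain k where k: "mpoly.dim A = mpoly.dim N + k" "h.S.dimension k ?K (h ` A)" by blast
  have "h.S.dim ?K (h ` A) = k"
  proof (cases "\<one>\<^bsub>R\<^esub> = \<zero>\<^bsub>R\<^esub>")
    case False
    have "subfield ?K R" by (rule h.img_is_subfield(2)[OF subfield_const_polys False])
    from h.S.dimI[OF this k(2)] show ?thesis by (simp add: over_def)
  next
    case True
    then have "carrier R = {\<zero>\<^bsub>R\<^esub>}" by (rule h.S.one_zeroD)
    then have "k' = 0" if "h.S.dimension k' ?K (h ` A)" for k'
      using h.S.dimension_trivial[OF that] by simp
    then show ?thesis using k(2) unfolding h.S.dim_def by (metis the_equality)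
  qed
  then show ?thesis using k(1) by (simp add: N_def)
qed

section \<open>Hilbert functions of graded quotients of the polynomial ring\<close>

definition hdim :: "nat \<Rightarrow> ('k::field) mpoly set \<Rightarrow> int \<Rightarrow> nat" where
  "hdim n J j = mpoly.dim (homog_polys n j :: 'k mpoly set) - mpoly.dim (J \<inter> homog_polys n j)"

lemma dim_homog_mono:
  fixes A B :: "('k::field) mpoly set"
  assumes "A \<subseteq> B" "B \<subseteq> homog_polys n j"
  shows "mpoly.dim A \<le> mpoly.dim B"
proof -
  obtain F where "finite F" "homog_polys n j \<subseteq> mpoly.span (F :: 'k mpoly set)"
    by (rule homog_polys_finite_span)
  then show ?thesis using mpoly.dim_mono_finite_span[of A B F] assms by blast
qed

text \<open>Multiplication by \<open>l\<close> on the quotient by \<open>J\<close>, from degree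
  \<open>j\<close> to \<open>j + 1\<close>, has kernel \<open>J : l\<close> modulo \<open>J\<close>
  and cokernel the quotient by \<open>J + (l)\<close>. Rank-nullity is applied to this map with
  \<open>B\<close> the degree \<open>j + 1\<close> part of \<open>J\<close>.\<close>

lemma hdim_split:
  fixes J :: "('k::field) mpoly set"
  assumes J: "graded_ideal n J" and l: "l \<in> homog_polys n 1"
  shows "hdim n J (j + 1) = hdim n (mcolon n J l) j + hdim n (mplus n J l) (j + 1)"
proof -
  have I: "ideal J (mpoly_ring n)" and h: "\<And>p j. p \<in> J \<Longrightarrow> hcomp j p \<in> J"
    using J by (auto simp: graded_ideal_def)
  let ?A = "homog_polys n j :: 'k mpoly set" and ?B = "J \<inter> homog_polys n (j + 1)"
  obtain F where F: "finite F" "?A \<subseteq> mpoly.span F" by (rule homog_polys_finite_span)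
  obtain G where G: "finite G" "homog_polys n (j + 1) \<subseteq> mpoly.span (G :: 'k mpoly set)"
    by (rule homog_polys_finite_span)
  have mul: "a * l \<in> homog_polys n (j + 1)" if "a \<in> ?A" for a
    using homog_polys_mult[OF that l] .
  have "mpoly.dim {b + a * l | b a. b \<in> ?B \<and> a \<in> ?A} + mpoly.dim {a \<in> ?A. a * l \<in> ?B} =
      mpoly.dim ?A + mpoly.dim ?B"
    using F G subspace_homog_polys subspace_graded[OF I]
    by (intro mpoly.dim_sum_image[where F = F and G = G])
      (auto simp: mpoly_scale_def distrib_right mult.assoc)
  moreover have "{b + a * l | b a. b \<in> ?B \<and> a \<in> ?A} = mplus n J l \<inter> homog_polys n (j + 1)"
  proof (intro subset_antisym subsetI)
    fix x assume "x \<in> {b + a * l | b a. b \<in> ?B \<and> a \<in> ?A}"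
    then show "x \<in> mplus n J l \<inter> homog_polys n (j + 1)"
      using mpoly.subspace_add[OF subspace_homog_polys] mul homog_polys_carrier
      by (fastforce simp: mplus_def)
  next
    \<comment> \<open>The given \<open>p\<close> and \<open>q\<close> may be inhomogeneous; taking
      components of degrees \<open>j + 1\<close> and \<open>j\<close> replaces them by
      forms.\<close>
    fix x assume x: "x \<in> mplus n J l \<inter> homog_polys n (j + 1)"
    then obtain p q where pq: "x = p + q * l" "p \<in> J" "q \<in> carrier (mpoly_ring n)"
      by (auto simp: mplus_def)
    have "x = hcomp (j + 1) x" using x hcomp_homog[of x n "j + 1"] by simp
    also have "\<dots> = hcomp (j + 1) p + hcomp j q * l"
      unfolding pq(1) by (simp add: hcomp_add hcomp_mult_homog[OF l])
    finally show "x \<in> {b + a * l | b a. b \<in> ?B \<and> a \<in> ?A}"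
      using h[OF pq(2)] hcomp_in_homog pq mpoly_idealD(1)[OF I] by blast
  qed
  moreover have "{a \<in> ?A. a * l \<in> ?B} = mcolon n J l \<inter> ?A"
    using mul by (auto simp: mcolon_def homog_polys_carrier)
  ultimately have "mpoly.dim (mplus n J l \<inter> homog_polys n (j + 1)) + mpoly.dim (mcolon n J l \<inter> ?A) =
      mpoly.dim ?A + mpoly.dim ?B" by simp
  \<comment> \<open>The remaining inequalities ensure that none of the subtractions hidden in
    \<open>hdim\<close> is truncated.\<close>
  moreover have "J \<subseteq> mplus n J l" by (force simp: mplus_def)
  then have "mpoly.dim ?B \<le> mpoly.dim (mplus n J l \<inter> homog_polys n (j + 1))"
    by (intro dim_homog_mono) auto
  moreover have "mpoly.dim (mplus n J l \<inter> homog_polys n (j + 1)) \<le> mpoly.dim (homog_polys n (j + 1) :: 'k mpoly set)"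
    by (intro dim_homog_mono) auto
  moreover have "mpoly.dim (mcolon n J l \<inter> ?A) \<le> mpoly.dim ?A"
    by (intro dim_homog_mono) auto
  ultimately show ?thesis by (simp add: hdim_def)
qed

lemma hdim_mono:
  fixes J J' :: "('k::field) mpoly set"
  assumes "mpoly.dim (J \<inter> homog_polys n j) \<le> mpoly.dim (J' \<inter> homog_polys n j)"
  shows "hdim n J' j \<le> hdim n J j"
  using assms by (simp add: hdim_def)

lemma hdim_eq_0: "homog_polys n j \<subseteq> J \<Longrightarrow> hdim n J j = 0"
  by (simp add: hdim_def Int_absorb1)

text \<open>The degree 1 part of the ideal gains \<open>l\<close>. This supplies the drop by one
  that \<open>green 1\<close> demands.\<close>

lemma hdim_mplus_less:
  fixes J :: "('k::field) mpoly set"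
  assumes J: "graded_ideal n J" and l: "l \<in> homog_polys n 1" "l \<notin> J"
  shows "hdim n (mplus n J l) 1 < hdim n J 1"
proof -
  have I: "ideal J (mpoly_ring n)" "ideal (mplus n J l) (mpoly_ring n)"
    using J graded_mplus[OF J l(1)] by (auto simp: graded_ideal_def)
  have "l = 0 + 1 * l" by simp
  then have "l \<in> mplus n J l"
    unfolding mplus_def using mpoly_idealD(2)[OF I(1)] mpoly_carrier_1 by blast
  moreover have "J \<subseteq> mplus n J l" by (force simp: mplus_def)
  ultimately have "J \<inter> homog_polys n 1 \<subset> mplus n J l \<inter> homog_polys n 1" using l by blast
  moreover obtain F where "finite F" "homog_polys n 1 \<subseteq> mpoly.span (F :: 'k mpoly set)"
    by (rule homog_polys_finite_span)
  ultimately have "mpoly.dim (J \<inter> homog_polys n 1) < mpoly.dim (mplus n J l \<inter> homog_polys n 1)"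
    using subspace_graded[OF I(1)] subspace_graded[OF I(2)]
    by (intro mpoly.dim_strict_mono_finite_span[of _ _ F]) auto
  moreover have "mpoly.dim (mplus n J l \<inter> homog_polys n 1) \<le> mpoly.dim (homog_polys n 1 :: 'k mpoly set)"
    by (intro dim_homog_mono) auto
  ultimately show ?thesis by (simp add: hdim_def)
qed

text \<open>The inductive core, for an abstract family \<open>T\<close> of polynomial ideals. The
  assumptions \<open>regular\<close>, \<open>final\<close> and \<open>swap\<close> are the
  translations of (i), (ii) and (iii).\<close>

lemma hdim_mplus_le_green:
  fixes T :: "letter list \<Rightarrow> ('k::field) mpoly set"
  assumes T: "\<And>os. length os \<le> r \<Longrightarrow> graded_ideal n (T os)"
    and l: "\<And>i. i < r \<Longrightarrow> l i \<in> homog_polys n 1"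
    and Lc: "\<And>os. length os < r \<Longrightarrow> T (os @ [Lc]) = mcolon n (T os) (l (length os))"
    and Ls: "\<And>os. length os < r \<Longrightarrow> T (os @ [Ls]) = mplus n (T os) (l (length os))"
    and regular: "\<And>os. length os < r \<Longrightarrow> \<not> homog_polys n 1 \<subseteq> T os \<Longrightarrow> l (length os) \<notin> T os"
    and final: "\<And>os j. length os = r \<Longrightarrow> num_c os < d \<Longrightarrow> j > 0 \<Longrightarrow> homog_polys n j \<subseteq> T os"
    and swap: "\<And>os. length os + 2 \<le> r \<Longrightarrow>
      mpoly.dim (T (os @ [Lc, Ls]) \<inter> homog_polys n (int d - int (num_c os) - 1)) \<le>
      mpoly.dim (T (os @ [Ls, Lc]) \<inter> homog_polys n (int d - int (num_c os) - 1))"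
    and "length os < r" "num_c os < d"
  shows "hdim n (T (os @ [Ls])) (int (d - num_c os)) \<le>
    green (d - num_c os) (hdim n (T os) (int (d - num_c os)))"
  using assms(8,9)
proof (induction "r - length os" arbitrary: os rule: less_induct)
  case less
  let ?D = "d - num_c os" and ?l = "l (length os)"
  have num: "num_c (os @ [Ls]) = num_c os" "num_c (os @ [Lc]) = Suc (num_c os)"
    by (simp_all add: num_c_def)
  have g: "graded_ideal n (T os)" using T less by simp
  have ll: "?l \<in> homog_polys n 1" using l less by simp
  show ?case
  proof (cases "length os + 1 = r")
    case True
    \<comment> \<open>The last form has been used and fewer than \<open>d\<close> letters
      \<open>c\<close> occur, so (ii) annihilates the positive degree \<open>D\<close>.\<close>
    have "homog_polys n (int ?D) \<subseteq> T (os @ [Ls])"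
      using True less num by (intro final) auto
    then show ?thesis by (simp add: hdim_eq_0)
  next
    case len: False
    show ?thesis
    proof (cases "?D = 1")
      \<comment> \<open>Here \<open>(o,c)\<close> would contain \<open>d\<close> letters
        \<open>c\<close>, beyond the range of the induction hypothesis. Since \<open>green 1\<close>
        subtracts one, a strict drop suffices, unless degree 1 already vanishes.\<close>
      case True
      show ?thesis
      proof (cases "homog_polys n 1 \<subseteq> T os")
        case True
        moreover have "T os \<subseteq> T (os @ [Ls])" using Ls less by (force simp: mplus_def)
        ultimately have "homog_polys n 1 \<subseteq> T (os @ [Ls])" by blast
        then show ?thesis using \<open>?D = 1\<close> by (simp add: hdim_eq_0)
      next
        case False
        then have "hdim n (T (os @ [Ls])) 1 < hdim n (T os) 1"
          using Ls regular less hdim_mplus_less[OF g ll] by auto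
        then show ?thesis using True by (simp add: green_1)
      qed
    next
      case False
      define e where "e = ?D - 1"
      have e: "?D = Suc e" "e > 0" using False less.prems(2) by (auto simp: e_def)
      have split: "hdim n (T os) (int ?D) =
          hdim n (T (os @ [Lc])) (int e) + hdim n (T (os @ [Ls])) (int ?D)"
        using hdim_split[OF g ll, of "int e"] Lc Ls less e by (simp add: add.commute)
      have "graded_ideal n (T (os @ [Ls]))" using T less by simp
      then have "hdim n (T (os @ [Ls])) (int ?D) =
          hdim n (T (os @ [Ls, Lc])) (int e) + hdim n (T (os @ [Ls, Ls])) (int ?D)"
        using hdim_split[OF _ l[of "Suc (length os)"], of "T (os @ [Ls])" "int e"]
          Lc[of "os @ [Ls]"] Ls[of "os @ [Ls]"] less len e by (simp add: add.commute)
      \<comment> \<open>Condition (iii) compares ideals; codimensions compare the other way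
        round.\<close>
      also have "hdim n (T (os @ [Ls, Lc])) (int e) \<le> hdim n (T (os @ [Lc, Ls])) (int e)"
      proof (rule hdim_mono)
        have "int d - int (num_c os) - 1 = int e" using e less by linarith
        then show "mpoly.dim (T (os @ [Lc, Ls]) \<inter> homog_polys n (int e)) \<le>
            mpoly.dim (T (os @ [Ls, Lc]) \<inter> homog_polys n (int e))"
          using swap[of os] less len by simp
      qed
      also have "hdim n (T (os @ [Lc, Ls])) (int e) \<le> green e (hdim n (T (os @ [Lc])) (int e))"
      proof -
        have "d - Suc (num_c os) = e" using e by simp
        then show ?thesis
          using less(1)[of "os @ [Lc]", unfolded num] less(2,3) len e by simp
      qed
      also have "hdim n (T (os @ [Ls, Ls])) (int ?D) \<le> green ?D (hdim n (T (os @ [Ls])) (int ?D))"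
        using less(1)[of "os @ [Ls]"] less(2,3) len num e by simp
      finally show ?thesis
        \<comment> \<open>By \<open>split\<close>, \<open>h(o,c)\<close> is the difference
          \<open>c - x\<close> in \<open>green_self_bound\<close>, with \<open>c = h(o)\<close> and
          \<open>x = h(o,s)\<close>.\<close>
        using split e by (intro green_self_bound) (simp_all add: ac_simps)
    qed
  qed
qed

section \<open>Passage to the standard graded algebra\<close>

text \<open>When \<open>J\<close> is an ideal, the polynomial ring modulo this preimage is
  \<open>R/J\<close>, so Hilbert functions can be computed upstairs.\<close>

definition pullback :: "nat \<Rightarrow> ('k::field) mpoly set \<Rightarrow> 'k mpoly set set \<Rightarrow> 'k mpoly set" where
  "pullback n I J = {p \<in> carrier (mpoly_ring n). I +>\<^bsub>mpoly_ring n\<^esub> p \<in> J}"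

context
  fixes n :: nat and I :: "('k::field) mpoly set"
  assumes I: "ideal I (mpoly_ring n)"
begin

private abbreviation (input) "R \<equiv> std_alg n I"
private abbreviation (input) "cls \<equiv> \<lambda>p. I +>\<^bsub>mpoly_ring n\<^esub> p"

lemma cls_hom: "ring_hom_ring (mpoly_ring n) R cls"
  unfolding std_alg_def by (rule ideal.rcos_ring_hom_ring[OF I])

lemma std_alg_cring: "cring R"
  unfolding std_alg_def by (rule ideal.quotient_is_cring[OF I mpoly_ring_cring])

lemma std_alg_carrier: "carrier R = cls ` carrier (mpoly_ring n)"
  by (auto simp: std_alg_def FactRing_def A_RCOSETS_def')

lemma cls_eq_zero_iff: "p \<in> carrier (mpoly_ring n) \<Longrightarrow> cls p = \<zero>\<^bsub>R\<^esub> \<longleftrightarrow> p \<in> I"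
  using ideal.rcos_const_imp_mem[OF I, of p] ring.a_rcos_zero[OF cring.axioms(1)[OF mpoly_ring_cring] I]
  by (auto simp: std_alg_def FactRing_def)

lemma cls_closed: "p \<in> carrier (mpoly_ring n) \<Longrightarrow> cls p \<in> carrier R"
  by (auto simp: std_alg_carrier)

lemma cls_add:
  "p \<in> carrier (mpoly_ring n) \<Longrightarrow> q \<in> carrier (mpoly_ring n) \<Longrightarrow> cls (p + q) = cls p \<oplus>\<^bsub>R\<^esub> cls q"
  using ring_hom_add[OF ring_hom_ring.homh[OF cls_hom]] by simp

lemma cls_mult:
  "p \<in> carrier (mpoly_ring n) \<Longrightarrow> q \<in> carrier (mpoly_ring n) \<Longrightarrow> cls (p * q) = cls p \<otimes>\<^bsub>R\<^esub> cls q"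
  using ring_hom_mult[OF ring_hom_ring.homh[OF cls_hom]] by simp

lemma pullback_zero: "pullback n I {\<zero>\<^bsub>R\<^esub>} = I"
proof -
  have "p \<in> carrier (mpoly_ring n) \<and> cls p = \<zero>\<^bsub>R\<^esub> \<longleftrightarrow> p \<in> I" for p
    using cls_eq_zero_iff mpoly_idealD(1)[OF I] by blast
  then show ?thesis by (simp add: pullback_def)
qed

lemma pullback_colon:
  assumes "l \<in> carrier (mpoly_ring n)"
  shows "pullback n I (colon_ideal R J (cls l)) = mcolon n (pullback n I J) l"
  using assms by (auto simp: pullback_def mcolon_def colon_ideal_def cls_mult cls_closed mpoly_carrier_mult)

lemma pullback_plus:
  assumes l: "l \<in> carrier (mpoly_ring n)" and J: "J \<subseteq> carrier R"
  shows "pullback n I (J <+>\<^bsub>R\<^esub> genideal R {cls l}) = mplus n (pullback n I J) l"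
proof -
  interpret R: cring R by (rule std_alg_cring)
  have gen: "genideal R {cls l} = {x \<otimes>\<^bsub>R\<^esub> cls l | x. x \<in> carrier R}"
    using R.cgenideal_eq_genideal[OF cls_closed[OF l]] by (simp add: cgenideal_def)
  show ?thesis
  proof (intro subset_antisym subsetI)
    fix p assume "p \<in> pullback n I (J <+>\<^bsub>R\<^esub> genideal R {cls l})"
    then obtain a q where p: "p \<in> carrier (mpoly_ring n)" and a: "a \<in> J"
      and q: "q \<in> carrier (mpoly_ring n)" and eq: "cls p = a \<oplus>\<^bsub>R\<^esub> cls q \<otimes>\<^bsub>R\<^esub> cls l"
      unfolding pullback_def gen set_add_def' std_alg_carrier by blast
    \<comment> \<open>Subtracting the multiple of \<open>l\<close> from \<open>p\<close> leaves a
      lift of \<open>a\<close>.\<close>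
    let ?r = "p + - (q * l)"
    have ql: "q * l \<in> carrier (mpoly_ring n)" using q l by (rule mpoly_carrier_mult)
    then have r: "?r \<in> carrier (mpoly_ring n)" using p mpoly_carrier_add mpoly_carrier_uminus by blast
    have "cls ?r \<oplus>\<^bsub>R\<^esub> cls (q * l) = a \<oplus>\<^bsub>R\<^esub> cls (q * l)"
      using cls_add[OF r ql] eq q l by (simp add: cls_mult)
    then have "cls ?r = a"
      using R.add.right_cancel[OF cls_closed[OF ql] cls_closed[OF r]] a J by blast
    then have "?r \<in> pullback n I J" using a r by (simp add: pullback_def)
    moreover have "p = ?r + q * l" by simp
    ultimately show "p \<in> mplus n (pullback n I J) l" unfolding mplus_def using q by blast
  next
    fix p assume "p \<in> mplus n (pullback n I J) l"
    then obtain t q where t: "t \<in> carrier (mpoly_ring n)" "cls t \<in> J"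
      and q: "q \<in> carrier (mpoly_ring n)" and p: "p = t + q * l"
      by (auto simp: mplus_def pullback_def)
    have "cls p = cls t \<oplus>\<^bsub>R\<^esub> cls q \<otimes>\<^bsub>R\<^esub> cls l" "p \<in> carrier (mpoly_ring n)"
      using t q l by (simp_all add: p cls_add cls_mult mpoly_carrier_mult mpoly_carrier_add)
    then show "p \<in> pullback n I (J <+>\<^bsub>R\<^esub> genideal R {cls l})"
      using t(2) cls_closed[OF q] unfolding pullback_def gen set_add_def' by blast
  qed
qed

lemma std_scalars_eq: "std_scalars n I = cls ` range const_poly"
  by (simp add: std_scalars_def image_image)

text \<open>The forms of degree \<open>j\<close> in the preimage map onto those of \<open>J\<close>
  with kernel \<open>I\<close> in degree \<open>j\<close>. The subtracted term is the same for every
  \<open>J\<close>, so comparing dimensions in R amounts to comparing them upstairs.\<close>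

lemma std_dim_eq:
  assumes J: "ideal (pullback n I J) (mpoly_ring n)" and "I \<subseteq> pullback n I J"
  shows "std_dim n I (J \<inter> std_comp n I j) =
    mpoly.dim (pullback n I J \<inter> homog_polys n j) - mpoly.dim (I \<inter> homog_polys n j)"
proof -
  let ?A = "pullback n I J \<inter> homog_polys n j"
  obtain F where F: "finite F" "homog_polys n j \<subseteq> mpoly.span (F :: 'k mpoly set)"
    by (rule homog_polys_finite_span)
  have "J \<inter> std_comp n I j = cls ` ?A"
    by (auto simp: std_comp_def pullback_def homog_polys_carrier)
  moreover have "{a \<in> ?A. cls a = \<zero>\<^bsub>R\<^esub>} = {a \<in> ?A. a \<in> I}"
    by (intro Collect_cong conj_cong refl cls_eq_zero_iff) (simp add: pullback_def)
  moreover have "{a \<in> ?A. a \<in> I} = I \<inter> homog_polys n j" using assms(2) by blast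
  moreover have "ring.dim R (cls ` range const_poly) (cls ` ?A) =
      mpoly.dim ?A - mpoly.dim {a \<in> ?A. cls a = \<zero>\<^bsub>R\<^esub>}"
    using F homog_polys_carrier
    by (intro dim_hom_image[OF cls_hom subspace_graded[OF J], of j F]) auto
  ultimately show ?thesis by (simp add: std_dim_def std_scalars_eq)
qed

lemma std_dim_comp: "std_dim n I (std_comp n I j) = hdim n I j"
proof -
  \<comment> \<open>\<open>std_dim_eq\<close> asks only that the preimage be an ideal, so
    \<open>UNIV\<close> can stand for all of R.\<close>
  have UNIV: "pullback n I UNIV = carrier (mpoly_ring n)" by (simp add: pullback_def)
  have "homog_polys n j \<subseteq> (carrier (mpoly_ring n) :: 'k mpoly set)"
    using homog_polys_carrier by blast
  then have "(carrier (mpoly_ring n) :: 'k mpoly set) \<inter> homog_polys n j = homog_polys n j" by blast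
  moreover have "ideal (carrier (mpoly_ring n)) (mpoly_ring n :: 'k mpoly ring)"
    by (rule ring.oneideal[OF cring.axioms(1)[OF mpoly_ring_cring]])
  ultimately show ?thesis
    using std_dim_eq[of UNIV j] mpoly_idealD(1)[OF I] by (simp add: UNIV hdim_def)
qed

text \<open>The composite of the two quotient maps has the pullback of \<open>J\<close> as its
  kernel, and it carries constants to the scalars of \<open>R/J\<close>.\<close>

lemma quot_comp_dim_eq:
  assumes J: "ideal J R"
  shows "quot_comp_dim n I J j = hdim n (pullback n I J) j"
proof -
  interpret R: cring R by (rule std_alg_cring)
  let ?q = "\<lambda>x. J +>\<^bsub>R\<^esub> x"
  interpret J: ideal J R by (rule J)
  have "ring_hom_ring (mpoly_ring n) (R Quot J) (?q \<circ> cls)"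
  proof (rule ring_hom_ringI2)
    show "ring (mpoly_ring n)" by (rule cring.axioms(1)[OF mpoly_ring_cring])
    show "ring (R Quot J)" by (rule J.quotient_is_ring)
    show "?q \<circ> cls \<in> ring_hom (mpoly_ring n) (R Quot J)"
      using ring_hom_trans[OF ring_hom_ring.homh[OF cls_hom] J.rcos_ring_hom] .
  qed
  moreover obtain F where F: "finite F" "homog_polys n j \<subseteq> mpoly.span (F :: 'k mpoly set)"
    by (rule homog_polys_finite_span)
  moreover have "homog_polys n j \<subseteq> carrier (mpoly_ring n)" using homog_polys_carrier by blast
  ultimately have "ring.dim (R Quot J) ((?q \<circ> cls) ` range const_poly) ((?q \<circ> cls) ` homog_polys n j) =
      mpoly.dim (homog_polys n j :: 'k mpoly set) -
      mpoly.dim {a \<in> homog_polys n j. (?q \<circ> cls) a = \<zero>\<^bsub>R Quot J\<^esub>}"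
    by (intro dim_hom_image[OF _ subspace_homog_polys])
  moreover have "?q x = \<zero>\<^bsub>R Quot J\<^esub> \<longleftrightarrow> x \<in> J" if "x \<in> carrier R" for x
    using J.rcos_const_imp_mem[OF that] R.a_rcos_zero[OF J] by (auto simp: FactRing_def)
  then have "{a \<in> homog_polys n j. (?q \<circ> cls) a = \<zero>\<^bsub>R Quot J\<^esub>} = {a \<in> homog_polys n j. cls a \<in> J}"
    by (intro Collect_cong conj_cong refl) (simp add: cls_closed homog_polys_carrier)
  moreover have "{a \<in> homog_polys n j. cls a \<in> J} = pullback n I J \<inter> homog_polys n j"
    by (auto simp: pullback_def homog_polys_carrier)
  ultimately show ?thesis
    by (simp add: quot_comp_dim_def std_scalars_eq std_comp_def hdim_def image_image)
qed

end

lemma seq_ideal_subset: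
  assumes "cring R" "set ls \<subseteq> carrier R" "length os \<le> length ls"
  shows "seq_ideal R ls os \<subseteq> carrier R"
  using assms(3)
proof (induction os rule: rev_induct)
  case Nil
  interpret cring R by fact
  show ?case by (simp add: seq_ideal_Nil)
next
  case (snoc a os)
  interpret cring R by fact
  have "ls ! length os \<in> carrier R" using snoc assms(2) nth_mem by fastforce
  then have "genideal R {ls ! length os} \<subseteq> carrier R"
    by - (rule additive_subgroup.a_subset[OF ideal.axioms(1)[OF genideal_ideal]], simp)
  then show ?case
    using snoc by (cases a) (auto simp: seq_ideal_snoc colon_ideal_def set_add_def')
qed

lemma subset_mcolon:
  assumes "ideal I (mpoly_ring n)" "I \<subseteq> J" "l \<in> carrier (mpoly_ring n)"
  shows "I \<subseteq> mcolon n J l"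
  using mpoly_idealD(1,4)[OF assms(1)] assms(2,3) by (fastforce simp: mcolon_def mult.commute)

lemma subset_mplus: "I \<subseteq> J \<Longrightarrow> I \<subseteq> mplus n J l"
  by (force simp: mplus_def)

section \<open>Green's bound for standard graded algebras\<close>

theorem theorem1p14:
  fixes n d :: nat
    and I :: "('k::field) mpoly set"
    and ls :: "'k mpoly set list"
  assumes "infinite (UNIV :: 'k set)"
    and "homogeneous_ideal n I"
    and "d > 0"
    and "ls \<noteq> []"
    and "set ls \<subseteq> std_comp n I 1"
    and "Gr_property n I ls d"
  shows "quot_comp_dim n I (genideal (std_alg n I) {ls ! 0}) (int d)
           \<le> macaulay_lower (std_dim n I (std_comp n I (int d))) d"
proof -
  let ?R = "std_alg n I" and ?S = "mpoly_ring n :: 'k mpoly ring" and ?r = "length ls"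
  have gI: "graded_ideal n I" using assms(2) by (rule homogeneous_imp_graded_ideal)
  then have I: "ideal I ?S" by (simp add: graded_ideal_def)
  interpret R: cring ?R by (rule std_alg_cring[OF I])
  have "\<exists>p. p \<in> homog_polys n 1 \<and> ls ! i = I +>\<^bsub>?S\<^esub> p" if "i < ?r" for i
    using assms(5) nth_mem[OF that] by (auto simp: std_comp_def)
  then obtain l where l: "\<And>i. i < ?r \<Longrightarrow> l i \<in> homog_polys n 1"
    and ls: "\<And>i. i < ?r \<Longrightarrow> ls ! i = I +>\<^bsub>?S\<^esub> l i" by metis
  have lS: "l i \<in> carrier ?S" if "i < ?r" for i using l[OF that] homog_polys_carrier by blast
  have lsR: "set ls \<subseteq> carrier ?R"
    using cls_closed[OF I] ls lS by (auto simp: in_set_conv_nth)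
  define T where "T os = pullback n I (seq_ideal ?R ls os)" for os
  have T_Nil: "T [] = I" by (simp add: T_def seq_ideal_Nil pullback_zero[OF I])
  have T_Lc: "T (os @ [Lc]) = mcolon n (T os) (l (length os))" if "length os < ?r" for os
    using that by (simp add: T_def seq_ideal_snoc ls pullback_colon[OF I] lS)
  have T_Ls: "T (os @ [Ls]) = mplus n (T os) (l (length os))" if "length os < ?r" for os
    using that seq_ideal_subset[OF std_alg_cring[OF I] lsR, of os]
    by (simp add: T_def seq_ideal_snoc ls pullback_plus[OF I] lS)
  have T: "graded_ideal n (T os) \<and> I \<subseteq> T os" if "length os \<le> ?r" for os
    using that
  proof (induction os rule: rev_induct)
    case Nil
    show ?case by (simp add: T_Nil gI)
  next
    case (snoc a os)
    then have os: "length os < ?r" "graded_ideal n (T os)" "I \<subseteq> T os" by auto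
    show ?case
    proof (cases a)
      case Lc
      then show ?thesis
        using os graded_mcolon[OF os(2) l] subset_mcolon[OF I os(3) lS] by (simp add: T_Lc)
    next
      case Ls
      then show ?thesis
        using os graded_mplus[OF os(2) l] subset_mplus[OF os(3)] by (simp add: T_Ls)
    qed
  qed
  have T_ideal: "ideal (T os) ?S" if "length os \<le> ?r" for os
    using T[OF that] by (simp add: graded_ideal_def)
  have max: "homog_polys n j \<subseteq> T os"
    if os: "length os \<le> ?r" "std_max_ideal n I \<subseteq> seq_ideal ?R ls os" and "j > 0" for os j
  proof (rule homog_polys_subset_ideal[OF T_ideal[OF os(1)] _ \<open>j > 0\<close>])
    fix i assume "i < n"
    then have "I +>\<^bsub>?S\<^esub> var_poly i \<in> std_max_ideal n I"
      unfolding std_max_ideal_def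
      using R.genideal_self[of "(\<lambda>i. I +>\<^bsub>?S\<^esub> var_poly i) ` {..<n}"]
        cls_closed[OF I var_poly_carrier] by auto
    then show "var_poly i \<in> T os"
      using os \<open>i < n\<close> var_poly_carrier by (auto simp: T_def pullback_def)
  qed
  note Gr = assms(6)[unfolded Gr_property_def, rule_format]
  \<comment> \<open>The empty sequence gives the claim: there \<open>D = d\<close>,
    \<open>T [] = I\<close>, and \<open>[Ls]\<close> yields the preimage of the ideal of the first
    form.\<close>
  have "hdim n (T ([] @ [Ls])) (int (d - num_c [])) \<le>
      green (d - num_c []) (hdim n (T []) (int (d - num_c [])))"
  proof (rule hdim_mplus_le_green[where r = ?r and n = n and T = T and l = l and d = d])
    fix os :: "letter list" assume os: "length os < ?r" "\<not> homog_polys n 1 \<subseteq> T os"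
    then have "ls ! length os \<notin> seq_ideal ?R ls os"
      using Gr[of os] max[of os 1] by auto
    then show "l (length os) \<notin> T os" using os by (auto simp: T_def pullback_def ls)
  next
    fix os :: "letter list" and j :: int assume "length os = ?r" "num_c os < d" "j > 0"
    then show "homog_polys n j \<subseteq> T os" using Gr[of os] max[of os j] by auto
  next
    fix os :: "letter list" assume os: "length os + 2 \<le> ?r"
    let ?j = "int d - int (num_c os) - 1"
    let ?c = "os @ [Lc, Ls]" and ?s = "os @ [Ls, Lc]"
    have len: "length ?c \<le> ?r" "length ?s \<le> ?r" using os by auto
    have "std_dim n I (seq_ideal ?R ls ?c \<inter> std_comp n I ?j) \<le>
        std_dim n I (seq_ideal ?R ls ?s \<inter> std_comp n I ?j)"
      using Gr[of os] os by simp
    moreover have dim: "std_dim n I (seq_ideal ?R ls a \<inter> std_comp n I ?j) =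
        mpoly.dim (T a \<inter> homog_polys n ?j) - mpoly.dim (I \<inter> homog_polys n ?j)"
      if "length a \<le> ?r" for a
      using T[OF that] T_ideal[OF that] std_dim_eq[OF I] by (simp add: T_def)
    \<comment> \<open>This makes the subtraction on the right-hand side exact, so the common term
      can be cancelled.\<close>
    moreover have "mpoly.dim (I \<inter> homog_polys n ?j) \<le> mpoly.dim (T ?s \<inter> homog_polys n ?j)"
      using T[OF len(2)] by (intro dim_homog_mono) auto
    ultimately show "mpoly.dim (T ?c \<inter> homog_polys n ?j) \<le> mpoly.dim (T ?s \<inter> homog_polys n ?j)"
      unfolding dim[OF len(1)] dim[OF len(2)] by linarith
  qed (use T l T_Lc T_Ls assms in \<open>auto simp: num_c_def\<close>)
  then have "hdim n (mplus n I (l 0)) (int d) \<le> green d (hdim n I (int d))"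
    using T_Ls[of "[]"] assms(4) by (simp add: T_Nil num_c_def)
  moreover have "mplus n I (l 0) = pullback n I (genideal ?R {ls ! 0})"
  proof -
    have "ls ! 0 \<in> carrier ?R" using assms(4) lsR by (metis length_greater_0_conv nth_mem subsetD)
    then have "ideal (genideal ?R {ls ! 0}) ?R" by (intro R.genideal_ideal) simp
    then have "genideal ?R {ls ! 0} \<subseteq> carrier ?R"
      by (intro additive_subgroup.a_subset ideal.axioms(1))
    then have "{\<zero>\<^bsub>?R\<^esub>} <+>\<^bsub>?R\<^esub> genideal ?R {ls ! 0} = genideal ?R {ls ! 0}"
      unfolding set_add_def' by force
    then show ?thesis
      using pullback_plus[OF I lS[of 0], of "{\<zero>\<^bsub>?R\<^esub>}"] assms(4)
      by (simp add: pullback_zero[OF I] ls)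
  qed
  moreover have "ideal (genideal ?R {ls ! 0}) ?R"
    using assms(4) lsR by (intro R.genideal_ideal) (metis empty_subsetI insert_subset length_greater_0_conv nth_mem subsetD)
  ultimately show ?thesis
    using assms(3) by (simp add: quot_comp_dim_eq[OF I] std_dim_comp[OF I] green_def)
qed

end
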